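(* Let $X$ be an integer-valued random variable with $\mathbb{E}[X]=0$, $\mathbb{P}(X<-1)=0$ and $\mathbb{P}(X=x)\sim L(x)/x^2$ as $x\to\infty$ (along integers), where $L$ is slowly varying at $\infty$. Let $W_0=0$, $W_n=X_1+\cdots+X_n$ with $(X_i)_{i\ge1}$ i.i.d. copies of $X$, and $\zeta=\inf\{i\ge1:W_i<0\}$. For $n$ large, let $(W^{(n)}_i:i\ge0)$ have the law of $(W_i:i\ge0)$ under $\mathbb{P}(\,\cdot\mid\zeta=n)$, and let $$Z^{(n)}=(Z^{(n)}_i:0\le i\le n):=\mathcal{V}(W_0,W_1,\ldots,W_{n-1},-1),$$ where $\mathcal{V}$ is the Vervaat transform. Then $$d_{\mathrm{TV}}\left((W^{(n)}_i:0\le i\le n),(Z^{(n)}_i:0\le i\le n)\right)\longrightarrow 0\quad\text{as } n\to\infty,$$ where $d_{\mathrm{TV}}$ denotes the total variation distance on $\mathbb{R}^{n+1}$ equipped with the product topology.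
   Context: Vervaat transform: for $n\in\mathbb{N}$ and a path $\mathbf{w}=(w_0,\ldots,w_n)$ with $w_0=0$ and integer increments $x_i=w_i-w_{i-1}$ ($1\le i\le n$), let $k_n=\min\{0\le i\le n: w_i=\min_{0\le j\le n}w_j\}$ be the first time the path reaches its overall minimum. Then $\mathcal{V}(\mathbf{w})=(\mathcal{V}(\mathbf{w})_i:0\le i\le n)$ is the path obtained by reading the increments in cyclic order starting just after time $k_n$: $\mathcal{V}(\mathbf{w})_0=0$ and $\mathcal{V}(\mathbf{w})_{i+1}-\mathcal{V}(\mathbf{w})_i=x_{k_n+1+i}$ for $0\le i<n$, indices being taken modulo $n$ in $\{1,\ldots,n\}$. The total variation distance between random variables means the total variation distance between their laws. *)

theory Defs
  imports "HOL-Probability.Probability" "HOL-Library.Landau_Symbols" "HOL-Library.Extended_Nat"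
begin

text \<open>Positivity and measurability are only required on a neighbourhood of infinity,
  since the values elsewhere are irrelevant.\<close>

definition slowly_varying :: "(real \<Rightarrow> real) \<Rightarrow> bool" where
  "slowly_varying L \<longleftrightarrow>
     (\<exists>a>0. set_borel_measurable borel {a..} L \<and> (\<forall>x\<ge>a. L x > 0)) \<and>
     (\<forall>t>0. ((\<lambda>x. L (t * x) / L x) \<longlongrightarrow> 1) at_top)"

text \<open>The supremum is over events of the common \<open>\<sigma>\<close>-algebra; the definition is meant for
  \<open>\<mu>\<close> and \<open>\<nu>\<close> with \<^term>\<open>sets \<mu> = sets \<nu>\<close>.\<close>

definition tv_dist :: "'a measure \<Rightarrow> 'a measure \<Rightarrow> real" where
  "tv_dist \<mu> \<nu> = (SUP A\<in>sets \<mu>. \<bar>measure \<mu> A - measure \<nu> A\<bar>)"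

definition walk :: "(nat \<Rightarrow> 'a \<Rightarrow> int) \<Rightarrow> nat \<Rightarrow> 'a \<Rightarrow> int" where
  "walk X n \<omega> = (\<Sum>i=1..n. X i \<omega>)"

text \<open>The infimum is taken in \<^typ>\<open>enat\<close>, so it is infinite if the path never becomes negative.\<close>

definition first_negative :: "(nat \<Rightarrow> int) \<Rightarrow> enat" where
  "first_negative w = Inf (enat ` {i. i \<ge> 1 \<and> w i < 0})"

text \<open>A path \<open>(w\<^sub>0, \<dots>, w\<^sub>n)\<close> is given by a function on \<^typ>\<open>nat\<close> together with its length \<open>n\<close>;
  only the values at \<open>0, \<dots>, n\<close> matter.\<close>

definition first_argmin :: "nat \<Rightarrow> (nat \<Rightarrow> int) \<Rightarrow> nat" where
  "first_argmin n w = (LEAST i. i \<le> n \<and> w i = Min (w ` {0..n}))"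

definition increment :: "(nat \<Rightarrow> int) \<Rightarrow> nat \<Rightarrow> int" where
  "increment w i = w i - w (i - 1)"

text \<open>The representative of \<open>k + 1 + i\<close> modulo \<open>n\<close> in \<open>{1, \<dots>, n}\<close> is \<open>(k + i) mod n + 1\<close>.\<close>

primrec vervaat :: "nat \<Rightarrow> (nat \<Rightarrow> int) \<Rightarrow> nat \<Rightarrow> int" where
  "vervaat n w 0 = 0"
| "vervaat n w (Suc i) = vervaat n w i + increment w ((first_argmin n w + i) mod n + 1)"

text \<open>Law on \<open>\<real>\<^bsup>n+1\<^esup>\<close>, i.e. on extensional functions on \<open>{0..n}\<close>. The product
  \<open>\<sigma>\<close>-algebra of the finitely many copies of \<^term>\<open>borel :: real measure\<close> is the Borel
  \<open>\<sigma>\<close>-algebra of the product topology.\<close>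

definition path_law :: "'a measure \<Rightarrow> nat \<Rightarrow> ('a \<Rightarrow> nat \<Rightarrow> int) \<Rightarrow> (nat \<Rightarrow> real) measure" where
  "path_law M n Y =
     distr M (Pi\<^sub>M {0..n} (\<lambda>_. borel)) (\<lambda>\<omega>. \<lambda>i\<in>{0..n}. real_of_int (Y \<omega> i))"

text \<open>If the conditioning event is null, \<^const>\<open>uniform_measure\<close> is the zero measure, whose
  \<^const>\<open>tv_dist\<close> to a probability measure is \<open>1\<close>. Convergence to \<open>0\<close> therefore entails that
  the conditioning is well defined for all large \<open>n\<close>.\<close>

definition W_law :: "'a measure \<Rightarrow> (nat \<Rightarrow> 'a \<Rightarrow> int) \<Rightarrow> nat \<Rightarrow> (nat \<Rightarrow> real) measure" where
  "W_law M X n =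
     path_law
       (uniform_measure M {\<omega>\<in>space M. first_negative (\<lambda>i. walk X i \<omega>) = enat n})
       n (\<lambda>\<omega> i. walk X i \<omega>)"

definition Z_law :: "'a measure \<Rightarrow> (nat \<Rightarrow> 'a \<Rightarrow> int) \<Rightarrow> nat \<Rightarrow> (nat \<Rightarrow> real) measure" where
  "Z_law M X n = path_law M n (\<lambda>\<omega>. vervaat n ((\<lambda>i. walk X i \<omega>)(n := -1)))"

end

theory Submission
  imports Defs
begin

text \<open>
  The walk follows the principle of one big jump. Let \<open>p\<close> be the step distribution and
  \<open>\<ell>(y) = E[X; X > y]\<close>. Since \<open>p(x) \<sim> L(x)/x\<^sup>2\<close>, the mean is carried by rare large steps:
  \<open>L = o(\<ell>)\<close> and \<open>E[X\<^sup>2; X \<le> y] = o(y \<ell>(y))\<close>. Steps that stay below a level \<open>b\<close> have mean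
  \<open>-\<ell>(b)\<close>, so with \<open>b\<^sub>n\<close> chosen such that \<open>b\<^sub>n \<approx> n \<ell>(b\<^sub>n)\<close> the first \<open>n - 1\<close> steps add up to
  about \<open>-b\<^sub>n\<close>, with fluctuations and a maximal step of smaller order. Closing the path at \<open>-1\<close>
  therefore means inserting one step close to \<open>b\<^sub>n\<close>, and near \<open>b\<^sub>n\<close> the density \<open>p\<close> is almost
  constant.

  Two facts turn this picture into a bound in total variation. The first is a lower bound for the
  density of the conditioned path relative to that of the closed path: on the event that the closing
  step lies in the window \<open>[(1 - t) b\<^sub>n, (1 + t) b\<^sub>n]\<close> and all other steps are smaller, conditioning on
  \<open>W\<^sub>n = -1\<close> gives the closing step the weight \<open>p(-1 - W\<^sub>n\<^sub>-\<^sub>1)\<close>, which is at least the minimum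
  \<open>p\<^sub>m\<close> of \<open>p\<close> over the window. The big step can sit at any of the \<open>n\<close> positions, and
  the Vervaat transform does not see which one, because it is invariant under cyclic rotations of a
  path ending at \<open>-1\<close>. Hence, up to the small probability of the complementary event,
  \<open>P(Z \<in> A) \<le> P(W\<^sub>n = -1, V(W) \<in> A) / (n p\<^sub>m)\<close> (\<open>closed_path_prob_le\<close>). The cycle lemma identifies
  the numerator with \<open>n P(\<zeta> = n, W \<in> A)\<close> (\<open>bridge_vervaat_prob\<close>).

  The second fact is the matching upper bound \<open>P(W\<^sub>n = -1) \<le> (1 + \<epsilon>) n p\<^sub>m\<close> (\<open>one_big_jump\<close>). By
  exchangeability \<open>P(W\<^sub>n = -1)\<close> is at most \<open>n\<close> times the probability that the last step is the
  largest, i.e. \<open>n E[p(-1 - W\<^sub>n\<^sub>-\<^sub>1); all steps \<le> -1 - W\<^sub>n\<^sub>-\<^sub>1]\<close>. Values of \<open>-1 - W\<^sub>n\<^sub>-\<^sub>1\<close> in the window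
  contribute at most a factor close to \<open>p\<^sub>m\<close>, and larger values are improbable. For values of size
  about \<open>b\<^sub>n / 2\<^sup>j\<close> the density \<open>p\<close> is larger by a factor of order \<open>8\<^sup>j\<close> at most, but a walk whose
  steps are all below \<open>y = b\<^sub>n / 2\<^sup>j\<close> has to end above \<open>-(1 - t) b\<^sub>n\<close>; a Chernoff bound with parameter
  \<open>\<kappa> / y\<close> shows that this has probability at most \<open>exp(-\<kappa> t 2\<^sup>j / 2)\<close>. As \<open>\<kappa>\<close> may be taken as large
  as needed, the sum of these contributions is a small multiple of \<open>p\<^sub>m\<close>. No local limit theorem
  enters: the local factor \<open>p(b\<^sub>n)\<close> always comes from the largest step.

  Together the two facts give \<open>P(Z \<in> A) \<le> P(W \<in> A | \<zeta> = n) + 2 \<epsilon>\<close> for all events \<open>A\<close>, and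
  the same inequality for the complement of \<open>A\<close> gives the converse bound.
\<close>

section \<open>Uniform convergence for slowly varying functions\<close>

text \<open>Pointwise convergence along a sequence makes the sets of shifts for which the increment is
  small from index \<open>n\<close> on increase to the whole interval, so their lengths converge to its length.\<close>

lemma slow_increments_mostly_small:
  fixes h :: "real \<Rightarrow> real" and z :: "nat \<Rightarrow> real"
  assumes meas: "h \<in> borel_measurable borel"
    and lim: "\<And>u. ((\<lambda>x. h (x + u) - h x) \<longlongrightarrow> 0) at_top"
    and z: "filterlim z at_top sequentially" and e: "e > 0" and S: "S \<ge> 0"
  shows "(\<lambda>n. measure lborel {s\<in>{0..S}. \<forall>m\<ge>n. \<bar>h (z m + s) - h (z m)\<bar> < e}) \<longlonglongrightarrow> S"
proof -
  let ?A = "\<lambda>n. {s\<in>{0..S}. \<forall>m\<ge>n. \<bar>h (z m + s) - h (z m)\<bar> < e}"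
  have m1: "(\<lambda>s. h (z m + s) - h (z m)) \<in> borel_measurable borel" for m
    using meas by measurable
  have A: "?A n \<in> sets lborel" for n
    using m1 by measurable
  have inc: "incseq ?A"
    by (auto simp: incseq_def)
  have un: "(\<Union>n. ?A n) = {0..S}"
  proof -
    have "\<exists>n. \<forall>m\<ge>n. \<bar>h (z m + s) - h (z m)\<bar> < e" for s
    proof -
      have "((\<lambda>m. h (z m + s) - h (z m)) \<longlongrightarrow> 0) sequentially"
        using filterlim_compose[OF lim z] .
      then have "\<forall>\<^sub>F m in sequentially. dist (h (z m + s) - h (z m)) 0 < e"
        using e tendstoD by blast
      then show ?thesis
        by (auto simp: eventually_sequentially dist_real_def)
    qed
    then show ?thesis by blast
  qed
  have "(\<lambda>n. measure lborel (?A n)) \<longlonglongrightarrow> measure lborel (\<Union>n. ?A n)"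
  proof (rule Lim_measure_incseq)
    show "range ?A \<subseteq> sets lborel" using A by blast
    show "emeasure lborel (\<Union>n. ?A n) \<noteq> \<infinity>" unfolding un using S by simp
  qed (rule inc)
  then show ?thesis
    using un S by simp
qed

text \<open>The uniform convergence theorem of Karamata theory in additive form. If uniformity failed
  along \<open>x\<^sub>n\<close> and \<open>u\<^sub>n\<close>, then the good shifts from \<open>x\<^sub>n\<close> and the good shifts from \<open>x\<^sub>n + u\<^sub>n\<close> would
  both fill almost all of their intervals; for large \<open>n\<close> these two sets of endpoints have a common
  point, and comparing both values of \<open>h\<close> with the value there contradicts the choice of \<open>u\<^sub>n\<close>.\<close>

lemma uniform_convergence_additive:
  fixes h :: "real \<Rightarrow> real"
  assumes meas: "h \<in> borel_measurable borel"
    and lim: "\<And>u. ((\<lambda>x. h (x + u) - h x) \<longlongrightarrow> 0) at_top"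
    and T: "T > 0" and e: "e > 0"
  shows "\<exists>B. \<forall>x\<ge>B. \<forall>u. 0 \<le> u \<longrightarrow> u \<le> T \<longrightarrow> \<bar>h (x + u) - h x\<bar> < e"
proof (rule ccontr)
  assume "\<not> ?thesis"
  then have "\<forall>B. \<exists>x u. x \<ge> B \<and> 0 \<le> u \<and> u \<le> T \<and> \<bar>h (x + u) - h x\<bar> \<ge> e"
    by (auto simp: not_less)
  then have "\<forall>n::nat. \<exists>x u. x \<ge> real n \<and> 0 \<le> u \<and> u \<le> T \<and> \<bar>h (x + u) - h x\<bar> \<ge> e"
    by blast
  then obtain x u where xu: "\<And>n. x n \<ge> real n" "\<And>n. 0 \<le> u n" "\<And>n. u n \<le> T"
      "\<And>n. \<bar>h (x n + u n) - h (x n)\<bar> \<ge> e"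
    by metis
  have x: "filterlim x at_top sequentially"
    by (rule filterlim_at_top_mono[OF filterlim_real_sequentially]) (simp add: xu(1))
  have y: "filterlim (\<lambda>n. x n + u n) at_top sequentially"
    by (rule filterlim_at_top_mono[OF x]) (simp add: xu(2))
  let ?A = "\<lambda>n. {s\<in>{0..2*T}. \<forall>m\<ge>n. \<bar>h (x m + s) - h (x m)\<bar> < e/2}"
  let ?B = "\<lambda>n. {s\<in>{0..T}. \<forall>m\<ge>n. \<bar>h (x m + u m + s) - h (x m + u m)\<bar> < e/2}"
  have "\<forall>\<^sub>F n in sequentially. measure lborel (?A n) > 3/2*T"
    by (rule order_tendstoD(1)[OF slow_increments_mostly_small[OF meas lim x]]) (use e T in simp_all)
  moreover have "\<forall>\<^sub>F n in sequentially. measure lborel (?B n) > 1/2*T"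
    by (rule order_tendstoD(1)[OF slow_increments_mostly_small[OF meas lim y]]) (use e T in simp_all)
  ultimately have "\<forall>\<^sub>F n in sequentially. measure lborel (?A n) > 3/2*T \<and> measure lborel (?B n) > 1/2*T"
    by (rule eventually_conj)
  then obtain n where n: "measure lborel (?A n) > 3/2*T" "measure lborel (?B n) > 1/2*T"
    using eventually_sequentially by auto
  \<comment> \<open>\<open>C\<close> is \<open>D\<close> translated by \<open>u n\<close>: both \<open>E\<close> and \<open>C\<close> live in \<open>{0..2*T}\<close> and are too large to be disjoint\<close>
  define D where "D = ?B n"
  define C where "C = (+) (- u n) -` D"
  have m1: "(\<lambda>s. h (x m + s) - h (x m)) \<in> borel_measurable borel"
    and m2: "(\<lambda>s. h (x m + u m + s) - h (x m + u m)) \<in> borel_measurable borel" for m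
    using meas by measurable
  define E where "E = ?A n"
  have mA: "E \<in> sets borel"
    unfolding E_def using m1 by measurable
  have mB: "D \<in> sets borel"
    unfolding D_def using m2 by measurable
  have shift: "(+) (- u n) \<in> borel_measurable borel"
    by measurable
  have mC: "C \<in> sets borel"
    using measurable_sets[OF shift mB] by (simp add: C_def)
  have "emeasure lborel D = emeasure (distr lborel borel ((+) (- u n))) D"
    by (simp only: lborel_distr_plus)
  also have "\<dots> = emeasure lborel C"
    using mB by (subst emeasure_distr) (simp_all add: C_def shift)
  finally have "measure lborel C > 1/2*T"
    using n(2) by (simp add: measure_def D_def)
  note C = this
  have CA: "C \<subseteq> {0..2*T}"
    using xu(2,3)[of n] by (auto simp: C_def D_def)
  have "E \<inter> C \<noteq> {}"
  proof
    assume dj: "E \<inter> C = {}"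
    have fin: "emeasure lborel D \<noteq> \<infinity>" if "D \<subseteq> {0..2*T}" for D
    proof -
      have "emeasure lborel D \<le> ennreal (2 * T)"
        using emeasure_mono[OF that, of lborel] T by simp
      then show ?thesis
        unfolding infinity_ennreal_def by (rule neq_top_trans[rotated]) simp
    qed
    have sub: "E \<union> C \<subseteq> {0..2*T}" using CA by (auto simp: E_def)
    have "measure lborel E + measure lborel C = measure lborel (E \<union> C)"
    proof (rule measure_Union[symmetric])
      show "emeasure lborel E \<noteq> \<infinity>" "emeasure lborel C \<noteq> \<infinity>"
        using sub by (intro fin; blast)+
    qed (use mA mC dj in simp_all)
    also have "\<dots> \<le> measure lborel {0..2*T}"
      using sub mA mC by (intro measure_mono_fmeasurable fmeasurableI2[OF fmeasurable_cbox[of 0 "2*T"]]) auto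
    also have "\<dots> = 2*T" using T by simp
    finally show False using n(1) C by (simp add: E_def)
  qed
  then obtain s where s: "s \<in> E" "s \<in> C" by auto
  have "\<bar>h (x n + s) - h (x n)\<bar> < e/2" using s(1) by (auto simp: E_def)
  moreover have "\<bar>h (x n + s) - h (x n + u n)\<bar> < e/2"
    using s(2) by (auto simp: C_def D_def dest: spec[of _ n])
  ultimately show False using xu(4)[of n] by linarith
qed

text \<open>The additive statement applied to \<open>ln \<circ> L \<circ> exp\<close>. The comparison is symmetric: \<open>x\<close> and \<open>y\<close>
  only have to be within a factor \<open>K\<close> of each other, so that either of them may be the larger one.\<close>

lemma slowly_varying_uniform:
  assumes L: "slowly_varying L" and K: "K \<ge> 1" and e: "e > 0"
  shows "\<exists>B>0. \<forall>x\<ge>B. \<forall>y. x \<le> K * y \<longrightarrow> y \<le> K * x \<longrightarrow> \<bar>L y - L x\<bar> \<le> e * L x \<and> L x > 0"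
proof -
  obtain a where a: "a > 0" "set_borel_measurable borel {a..} L" "\<And>x. x \<ge> a \<Longrightarrow> L x > 0"
    and lim: "\<And>t. t > 0 \<Longrightarrow> ((\<lambda>x. L (t * x) / L x) \<longlongrightarrow> 1) at_top"
    using L unfolding slowly_varying_def by blast
  \<comment> \<open>a globally positive and measurable function that agrees with \<open>L\<close> near infinity\<close>
  define G where "G x = (if x \<ge> a then L x else 1)" for x
  have Gm: "G \<in> borel_measurable borel"
  proof -
    have "(\<lambda>x. indicator {a..} x *\<^sub>R L x + indicator {..<a} x) \<in> borel_measurable borel"
      using a(2) unfolding set_borel_measurable_def by (intro borel_measurable_add) simp_all
    also have "(\<lambda>x. indicator {a..} x *\<^sub>R L x + indicator {..<a} x) = G"
      by (auto simp: G_def fun_eq_iff indicator_def)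
    finally show ?thesis .
  qed
  define h where "h x = ln (G (exp x))" for x
  have hm: "h \<in> borel_measurable borel" unfolding h_def using Gm by measurable
  have hl: "((\<lambda>x. h (x + u) - h x) \<longlongrightarrow> 0) at_top" for u
  proof -
    have "((\<lambda>x. L (exp u * exp x) / L (exp x)) \<longlongrightarrow> 1) at_top"
      using filterlim_compose[OF lim[of "exp u"] exp_at_top] by simp
    then have "((\<lambda>x. ln (L (exp u * exp x) / L (exp x))) \<longlongrightarrow> ln 1) at_top"
      by (intro tendsto_ln) auto
    moreover have "\<forall>\<^sub>F x in at_top. ln (L (exp u * exp x) / L (exp x)) = h (x + u) - h x"
      using eventually_ge_at_top[of "max (ln a) (ln a - u)"]
    proof eventually_elim
      case (elim x)
      have "exp (ln a) \<le> exp x" "exp (ln a) \<le> exp (x + u)" using elim by simp_all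
      then have "exp x \<ge> a" "exp (x + u) \<ge> a" using a(1) by simp_all
      then show ?case
        using a(3)[of "exp x"] a(3)[of "exp (x+u)"] by (simp add: h_def G_def ln_div exp_add mult.commute)
    qed
    ultimately show ?thesis by (simp add: filterlim_cong)
  qed
  obtain d where d: "d > 0" "\<And>s. \<bar>s\<bar> < d \<Longrightarrow> \<bar>exp s - 1\<bar> < (e::real)"
  proof -
    have "isCont (exp :: real \<Rightarrow> real) 0" by simp
    then have "\<exists>d>0. \<forall>s. \<bar>s - 0\<bar> < d \<longrightarrow> \<bar>exp s - exp (0::real)\<bar> < e"
      using e unfolding continuous_at_eps_delta dist_real_def by blast
    then show ?thesis using that by auto
  qed
  obtain B where B: "\<And>x u. x \<ge> B \<Longrightarrow> 0 \<le> u \<Longrightarrow> u \<le> ln K + 1 \<Longrightarrow> \<bar>h (x + u) - h x\<bar> < d"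
    using uniform_convergence_additive[OF hm hl, of "ln K + 1" d] K d(1) by (auto simp: add_nonneg_pos)
  define N where "N = K * max a (exp B)"
  have N: "N > 0" "N / K \<ge> a" "N / K \<ge> exp B" "N \<ge> a" "N \<ge> exp B"
  proof -
    show "N > 0" using K a(1) unfolding N_def by (intro mult_pos_pos) (simp_all add: less_max_iff_disj)
    have "N \<ge> 1 * max a (exp B)" unfolding N_def using K a(1) by (intro mult_right_mono) auto
    then show "N / K \<ge> a" "N / K \<ge> exp B" "N \<ge> a" "N \<ge> exp B" using K by (auto simp: N_def)
  qed
  show ?thesis
  proof (intro exI[of _ N] conjI allI impI)
    show "N > 0" by fact
    fix x y assume x: "x \<ge> N" and xy: "x \<le> K * y" "y \<le> K * x"
    have y: "y \<ge> N / K" using x xy(1) K by (simp add: field_simps)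
    have ax: "a \<le> x" "a \<le> y" and ex: "exp B \<le> x" "exp B \<le> y" using N x y by linarith+
    have x0: "x > 0" "y > 0" using ax a(1) by auto
    show "L x > 0" using a(3) ax by auto
    have "\<bar>h (ln y) - h (ln x)\<bar> < d"
    proof (cases "x \<le> y")
      case True
      have "ln y \<le> ln (K * x)" using xy(2) x0 K by (intro ln_mono) auto
      then have "ln y \<le> ln K + ln x" using x0 K by (simp add: ln_mult)
      moreover have "ln x \<ge> B" using ex x0 by (simp add: ln_ge_iff)
      ultimately show ?thesis using B[of "ln x" "ln y - ln x"] True x0 by auto
    next
      case False
      have "ln x \<le> ln (K * y)" using xy(1) x0 K by (intro ln_mono) auto
      then have "ln x \<le> ln K + ln y" using x0 K by (simp add: ln_mult)
      moreover have "ln y \<ge> B" using ex x0 by (simp add: ln_ge_iff)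
      ultimately show ?thesis using B[of "ln y" "ln x - ln y"] False x0 by (auto simp: abs_minus_commute)
    qed
    then have "\<bar>exp (h (ln y) - h (ln x)) - 1\<bar> < e" by (rule d(2))
    moreover have "exp (h (ln y) - h (ln x)) = L y / L x"
      using x0 ax a(3) by (simp add: h_def G_def exp_diff)
    ultimately have "\<bar>L y / L x - 1\<bar> < e" by simp
    moreover have "L y / L x - 1 = (L y - L x) / L x" using a(3)[OF ax(1)] by (simp add: field_simps)
    ultimately show "\<bar>L y - L x\<bar> \<le> e * L x" using a(3)[OF ax(1)] by (simp add: abs_divide pos_divide_less_eq)
  qed
qed

section \<open>Slowly varying sequences\<close>

text \<open>Slow variation along the integers, with the uniformity on windows of bounded ratio built in:
  for functions of a real variable it is a theorem, for sequences it has to be part of the notion.\<close>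

definition slowly_varying_seq :: "(nat \<Rightarrow> real) \<Rightarrow> bool" where
  "slowly_varying_seq r \<longleftrightarrow>
     (\<forall>K\<ge>1. \<forall>e>0. \<exists>N. \<forall>m\<ge>N. r m > 0 \<and>
        (\<forall>m'. real m \<le> K * real m' \<longrightarrow> real m' \<le> K * real m \<longrightarrow> \<bar>r m' - r m\<bar> \<le> e * r m))"

lemma slowly_varying_seq_asymp_equiv:
  assumes L: "slowly_varying L" and r: "r \<sim>[at_top] (\<lambda>m. L (real m))"
  shows "slowly_varying_seq r"
  unfolding slowly_varying_seq_def
proof (intro allI impI)
  fix K e :: real assume K: "K \<ge> 1" and e: "e > 0"
  define d where "d = min (1/2) (e/8)"
  have d: "d > 0" "d \<le> 1/2" "8 * d \<le> e" using e by (auto simp: d_def)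
  obtain B where B: "B > 0" "\<And>x y. x \<ge> B \<Longrightarrow> x \<le> K * y \<Longrightarrow> y \<le> K * x \<Longrightarrow> \<bar>L y - L x\<bar> \<le> d * L x \<and> L x > 0"
    using slowly_varying_uniform[OF L K d(1)] by blast
  obtain N0 where N0: "\<And>m. m \<ge> N0 \<Longrightarrow> \<bar>r m - L (real m)\<bar> \<le> d * \<bar>L (real m)\<bar>"
  proof -
    have "(\<lambda>m. r m - L (real m)) \<in> o(\<lambda>m. L (real m))"
      using r asymp_equiv_imp_diff_smallo by blast
    then have "\<forall>\<^sub>F m in at_top. norm (r m - L (real m)) \<le> d * norm (L (real m))"
      using d(1) landau_o.smallD by blast
    then show ?thesis using that by (auto simp: eventually_at_top_linorder)
  qed
  define N where "N = nat \<lceil>K * B + K * real N0 + real N0\<rceil>"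
  show "\<exists>N. \<forall>m\<ge>N. r m > 0 \<and>
        (\<forall>m'. real m \<le> K * real m' \<longrightarrow> real m' \<le> K * real m \<longrightarrow> \<bar>r m' - r m\<bar> \<le> e * r m)"
  proof (intro exI[of _ N] allI impI)
    fix m assume "m \<ge> N"
    then have m: "real m \<ge> K * B + K * real N0 + real N0" unfolding N_def by linarith
    have KB: "K * B \<ge> B" using mult_right_mono[of 1 K B] K B(1) by simp
    have KN: "K * real N0 \<ge> 0" using K by simp
    have mB: "real m \<ge> B" using m KB KN by linarith
    have mN: "m \<ge> N0" using m KN KB B(1) by linarith
    have "real m \<le> K * real m" using mult_right_mono[of 1 K "real m"] K by simp
    then have Lm: "L m > 0" using B(2)[of "real m" "real m"] mB by auto
    have rm: "\<bar>r m - L (real m)\<bar> \<le> d * L m" using N0[OF mN] Lm by simp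
    have d2: "d * L m \<le> 1/2 * L m" using d Lm by (intro mult_right_mono) auto
    have rm2: "r m \<ge> 1/2 * L m" using rm d2 by linarith
    show "r m > 0 \<and> (\<forall>m'. real m \<le> K * real m' \<longrightarrow> real m' \<le> K * real m \<longrightarrow> \<bar>r m' - r m\<bar> \<le> e * r m)"
    proof (intro conjI allI impI)
      show "r m > 0" using rm2 Lm by linarith
      fix m' assume mm: "real m \<le> K * real m'" "real m' \<le> K * real m"
      have "K * real m' \<ge> K * real N0" using mm m KB B(1) by linarith
      then have mN': "m' \<ge> N0" using K by simp
      have LL: "\<bar>L m' - L m\<bar> \<le> d * L m" using B(2)[OF mB mm] by simp
      then have L': "L m' \<le> 3/2 * L m" "L m' > 0" using d2 Lm by linarith+
      have "\<bar>r m' - L m'\<bar> \<le> d * L m'" using N0[OF mN'] L' by simp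
      moreover have "d * L m' \<le> d * (3/2 * L m)" using L' d by (intro mult_left_mono) auto
      moreover have "d * (3/2 * L m) = 3/2 * (d * L m)" by simp
      ultimately have "\<bar>r m' - r m\<bar> \<le> 3/2 * (d * L m) + d * L m + d * L m"
        using rm LL by linarith
      also have "\<dots> \<le> 8 * d * (1/2 * L m)" using d Lm by simp
      also have "\<dots> \<le> e * (1/2 * L m)" using d Lm by (intro mult_right_mono) auto
      also have "\<dots> \<le> e * r m" using e rm2 by (intro mult_left_mono) auto
      finally show "\<bar>r m' - r m\<bar> \<le> e * r m" .
    qed
  qed
qed

lemma slowly_varying_seqE:
  assumes "slowly_varying_seq r" "K \<ge> 1" "e > 0"
  obtains N where "\<And>m. m \<ge> N \<Longrightarrow> r m > 0"
    "\<And>m m'. m \<ge> N \<Longrightarrow> real m \<le> K * real m' \<Longrightarrow> real m' \<le> K * real m \<Longrightarrow> \<bar>r m' - r m\<bar> \<le> e * r m"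
proof -
  have "\<exists>N. \<forall>m\<ge>N. r m > 0 \<and>
        (\<forall>m'. real m \<le> K * real m' \<longrightarrow> real m' \<le> K * real m \<longrightarrow> \<bar>r m' - r m\<bar> \<le> e * r m)"
    using assms unfolding slowly_varying_seq_def by simp
  then show ?thesis using that by blast
qed

text \<open>Potter-type bounds. Halving the larger argument changes \<open>r\<close> by a factor of at most \<open>7/5\<close>,
  which is less than 2; iterating, \<open>r\<close> changes more slowly than linearly, and the sum up to \<open>y\<close> is
  dominated by its last dyadic block.\<close>

lemma slowly_varying_seq_growth:
  assumes "slowly_varying_seq r"
  shows "\<exists>N\<ge>1. (\<forall>m\<ge>N. r m > 0) \<and>
    (\<forall>m y. N \<le> m \<longrightarrow> m \<le> y \<longrightarrow> r m \<le> 2 * (real y / real m) * r y \<and> r y \<le> 2 * (real y / real m) * r m) \<and>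
    (\<forall>y\<ge>N. (\<Sum>i=N..y. r i) \<le> 10 * real y * r y)"
proof -
  obtain N1 where N1: "\<And>m. m \<ge> N1 \<Longrightarrow> r m > 0"
      "\<And>m m'. m \<ge> N1 \<Longrightarrow> real m \<le> 3 * real m' \<Longrightarrow> real m' \<le> 3 * real m \<Longrightarrow> \<bar>r m' - r m\<bar> \<le> 2/5 * r m"
    by (rule slowly_varying_seqE[OF assms, of 3 "2/5"]) (simp, simp, blast)
  \<comment> \<open>the window ratio 3 leaves room for the rounding in \<open>y div 2\<close>\<close>
  define N where "N = max 1 N1"
  have N: "N \<ge> 1" "N \<ge> N1" by (auto simp: N_def)
  have pos: "r m > 0" if "m \<ge> N" for m using N1(1) N that by auto
  have win: "r m' \<le> 7/5 * r m" if "m \<ge> N" "real m \<le> 3 * real m'" "real m' \<le> 3 * real m" for m m'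
  proof -
    have "\<bar>r m' - r m\<bar> \<le> 2/5 * r m" using N1(2)[of m m'] that N by simp
    then show ?thesis by linarith
  qed
  have A: "r m \<le> 2 * (real y / real m) * r y \<and> r y \<le> 2 * (real y / real m) * r m" if "N \<le> m" "m \<le> y" for m y
    using that
  proof (induction y rule: less_induct)
    case (less y)
    have m0: "real m > 0" using less.prems N by auto
    have ry: "r y > 0" "r m > 0" using pos less.prems by auto
    have ym: "real y / real m \<ge> 1" using less.prems m0 by simp
    have nn: "0 \<le> real y / real m * r y" "0 \<le> real y / real m * r m" using ry by simp_all
    show ?case
    proof (cases "y \<le> 3 * m")
      case True
      have "r m \<le> 7/5 * r y" "r y \<le> 7/5 * r m"
        using less.prems True win[of y m] win[of m y] by auto
      moreover have "7/5 * r y \<le> 2 * (real y / real m) * r y" "7/5 * r m \<le> 2 * (real y / real m) * r m"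
        using ym ry by (intro mult_right_mono; linarith)+
      ultimately show ?thesis by linarith
    next
      case False
      define y' where "y' = y div 2"
      have y': "y' < y" "m \<le> y'" "2 * y' \<le> y" "y \<le> 3 * y'" "y' \<ge> 1"
        using False less.prems N by (auto simp: y'_def)
      have IH: "r m \<le> 2 * (real y' / real m) * r y'" "r y' \<le> 2 * (real y' / real m) * r m"
        using less.IH[OF y'(1)] less.prems y' by auto
      have w: "r y' \<le> 7/5 * r y" "r y \<le> 7/5 * r y'"
        using less.prems y' win[of y y'] win[of y' y] by auto
      have q: "real y' / real m \<le> 1/2 * (real y / real m)"
        using y' m0 by (simp add: divide_right_mono field_simps)
      have q0: "real y' / real m \<ge> 0" by simp
      have "2 * (real y' / real m) * r y' \<le> (real y / real m) * (7/5 * r y)"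
        using q q0 w pos[of y'] y' less.prems by (intro mult_mono) auto
      moreover have "(real y / real m) * (7/5 * r y) \<le> 2 * (real y / real m) * r y"
        using nn unfolding mult.assoc mult.left_commute[of _ "7/5"] by (intro mult_right_mono) simp_all
      moreover have "7/5 * r y' \<le> 7/5 * ((real y / real m) * r m)"
      proof -
        have "2 * (real y' / real m) * r m \<le> (real y / real m) * r m"
          using q ry by (intro mult_right_mono) linarith+
        then show ?thesis by (intro mult_left_mono order_trans[OF IH(2)]) simp_all
      qed
      moreover have "7/5 * ((real y / real m) * r m) \<le> 2 * (real y / real m) * r m"
        using nn unfolding mult.assoc by (intro mult_right_mono) simp_all
      ultimately show ?thesis using IH w by (meson order_trans)
    qed
  qed
  have B: "(\<Sum>i=N..y. r i) \<le> 10 * real y * r y" if "N \<le> y" for y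
    using that
  proof (induction y rule: less_induct)
    case (less y)
    have ry: "r y > 0" using pos less.prems by auto
    have block: "(\<Sum>i=k..y. r i) \<le> real y * (7/5 * r y)" if "N \<le> k" "y \<le> 3 * k" for k
    proof -
      have "(\<Sum>i=k..y. r i) \<le> (\<Sum>i=k..y. 7/5 * r y)"
        using that less.prems by (intro sum_mono win) auto
      also have "\<dots> = real (card {k..y}) * (7/5 * r y)" by simp
      also have "\<dots> \<le> real y * (7/5 * r y)"
        using ry that N by (intro mult_right_mono) auto
      finally show ?thesis .
    qed
    show ?case
    proof (cases "y \<le> 3 * N")
      case True
      have "0 \<le> real y * r y" using ry by simp
      then show ?thesis using block[of N] True by (simp add: mult.assoc)
    next
      case False
      define y' where "y' = y div 2"
      have y': "y' < y" "N \<le> y'" "2 * y' \<le> y" "y \<le> 3 * y'"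
        using False less.prems N by (auto simp: y'_def)
      have "(\<Sum>i=N..y. r i) = (\<Sum>i=N..y'. r i) + (\<Sum>i=Suc y'..y. r i)"
        using y' by (subst sum.union_disjoint[symmetric]) (auto intro!: sum.cong)
      also have "(\<Sum>i=Suc y'..y. r i) \<le> real y * (7/5 * r y)"
        using y' by (intro block) auto
      also have "(\<Sum>i=N..y'. r i) \<le> 10 * real y' * r y'"
        using less.IH y' by auto
      also have "10 * real y' * r y' \<le> (5 * real y) * (7/5 * r y)"
        by (rule mult_mono) (use y' less.prems pos[of y'] win[of y y'] in simp_all)
      finally have "(\<Sum>i=N..y. r i) \<le> 42/5 * (real y * r y)" by simp
      also have "\<dots> \<le> 10 * (real y * r y)" using ry by (intro mult_right_mono) auto
      finally show ?thesis by simp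
    qed
  qed
  show ?thesis using N A B pos by blast
qed

text \<open>Each of the \<open>k\<close> dyadic blocks contributes at least \<open>1/2\<close>.\<close>

lemma harmonic_dyadic:
  assumes "y \<ge> (1::nat)"
  shows "real k / 2 \<le> (\<Sum>m=Suc y..2^k*y. 1 / real m)"
proof (induction k)
  case (Suc k)
  define z where "z = 2^k * y"
  have z: "z \<ge> 1" "z \<ge> y" using assms by (auto simp: z_def)
  have "(\<Sum>m=Suc y..2 * z. 1 / real m) = (\<Sum>m=Suc y..z. 1 / real m) + (\<Sum>m=Suc z..2*z. 1 / real m)"
    using z by (subst sum.union_disjoint[symmetric]) (auto intro!: sum.cong)
  moreover have "(\<Sum>m=Suc z..2*z. 1 / real m) \<ge> (\<Sum>m=Suc z..2*z. 1 / (2 * real z))"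
    by (intro sum_mono) (auto simp: field_simps)
  moreover have "(\<Sum>m=Suc z..2*z. 1 / (2 * real z)) = 1/2"
    using z by simp
  ultimately have "real (Suc k) / 2 \<le> (\<Sum>m=Suc y..2 * z. 1 / real m)"
    using Suc unfolding z_def[symmetric] by simp
  then show ?case by (simp add: z_def mult.assoc)
qed simp

section \<open>Truncated moments of the step distribution\<close>

text \<open>The law of a centred, downward skip-free step whose density varies regularly with
  index \<open>-2\<close> along the positive integers.\<close>

locale cauchy_step =
  fixes q :: "int pmf"
  assumes skip_free: "x \<in> set_pmf q \<Longrightarrow> x \<ge> -1"
    and integrable_id: "integrable (measure_pmf q) real_of_int"
    and centred: "measure_pmf.expectation q real_of_int = 0"
    and tail: "slowly_varying_seq (\<lambda>m. (real m)\<^sup>2 * pmf q (int m))"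
begin

definition p :: "nat \<Rightarrow> real" where "p m = pmf q (int m)"

text \<open>The slowly varying part of the density.\<close>

definition r :: "nat \<Rightarrow> real" where "r m = (real m)\<^sup>2 * p m"

text \<open>The mean carried by the steps beyond \<open>y\<close>. As the step is centred, \<open>- ell y\<close> is the mean
  of the step truncated at \<open>y\<close>.\<close>

definition ell :: "nat \<Rightarrow> real" where
  "ell y = measure_pmf.expectation q (\<lambda>x. if x > int y then real_of_int x else 0)"

definition second_moment_upto :: "nat \<Rightarrow> real" where
  "second_moment_upto y = measure_pmf.expectation q (\<lambda>x. if x \<le> int y then (real_of_int x)\<^sup>2 else 0)"

lemma slowly_varying_seq_r: "slowly_varying_seq r"
  using tail unfolding r_def p_def by simp

lemma p_nonneg: "p m \<ge> 0" by (simp add: p_def)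

lemma p_eq: "m \<ge> 1 \<Longrightarrow> p m = r m / (real m)\<^sup>2"
  by (simp add: r_def)

lemma integrable_tail: "integrable (measure_pmf q) (\<lambda>x. if x > int y then real_of_int x else 0)"
  by (rule Bochner_Integration.integrable_bound[OF integrable_id]) auto

lemma integrable_trunc:
  fixes f :: "int \<Rightarrow> real"
  shows "integrable (measure_pmf q) (\<lambda>x. if x \<le> int y then f x else 0)"
proof (rule measure_pmf.integrable_const_bound[where B = "\<Sum>x\<in>{-1..int y}. \<bar>f x\<bar>"])
  show "AE x in q. norm (if x \<le> int y then f x else 0) \<le> (\<Sum>x\<in>{-1..int y}. \<bar>f x\<bar>)"
  proof (rule AE_pmfI)
    fix x assume "x \<in> set_pmf q"
    then have "x \<ge> -1" by (rule skip_free)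
    then show "norm (if x \<le> int y then f x else 0) \<le> (\<Sum>x\<in>{-1..int y}. \<bar>f x\<bar>)"
      by (auto intro!: member_le_sum sum_nonneg)
  qed
qed simp

lemma ell_nonneg: "ell y \<ge> 0"
  unfolding ell_def by (intro Bochner_Integration.integral_nonneg) auto

lemma ell_antimono: "y \<le> y' \<Longrightarrow> ell y' \<le> ell y"
  unfolding ell_def by (intro integral_mono integrable_tail) auto

lemma truncated_mean: "measure_pmf.expectation q (\<lambda>x. if x \<le> int y then real_of_int x else 0) = - ell y"
proof -
  have "0 = measure_pmf.expectation q (\<lambda>x. (if x \<le> int y then real_of_int x else 0) + (if x > int y then real_of_int x else 0))"
    using centred by (intro trans[OF centred[symmetric]] Bochner_Integration.integral_cong) auto
  also have "\<dots> = measure_pmf.expectation q (\<lambda>x. if x \<le> int y then real_of_int x else 0) + ell y"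
    unfolding ell_def by (intro Bochner_Integration.integral_add integrable_trunc integrable_tail)
  finally show ?thesis by simp
qed

lemma ell_Suc: "ell y = ell (Suc y) + real (Suc y) * p (Suc y)"
proof -
  have "ell y = measure_pmf.expectation q (\<lambda>x. (if x > int (Suc y) then real_of_int x else 0) + (if x = int (Suc y) then real_of_int x else 0))"
    unfolding ell_def by (intro Bochner_Integration.integral_cong) auto
  also have "\<dots> = ell (Suc y) + measure_pmf.expectation q (\<lambda>x. if x = int (Suc y) then real_of_int x else 0)"
    unfolding ell_def
    by (intro Bochner_Integration.integral_add integrable_tail
        measure_pmf.integrable_const_bound[where B = "real (Suc y)"]) auto
  also have "measure_pmf.expectation q (\<lambda>x. if x = int (Suc y) then real_of_int x else 0) = real (Suc y) * p (Suc y)"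
    by (subst integral_measure_pmf[where A = "{int (Suc y)}"]) (auto simp: p_def split: if_splits)
  finally show ?thesis .
qed

lemma ell_ge_sum: "(\<Sum>m=Suc y..z. real m * p m) \<le> ell y"
proof (cases "y \<le> z")
  case True
  then have "(\<Sum>m=Suc y..z. real m * p m) = ell y - ell z"
  proof (induction z rule: dec_induct)
    case (step z)
    then show ?case using ell_Suc[of z] by simp
  qed simp
  then show ?thesis using ell_nonneg[of z] by simp
qed (use ell_nonneg[of y] in simp)

text \<open>\<open>ell y\<close> is the sum of \<open>r m / m\<close> over \<open>m > y\<close>; on the first \<open>k\<close> dyadic blocks \<open>r m\<close> is
  comparable to \<open>r y\<close>, so these blocks alone contribute a multiple \<open>k\<close> of \<open>r y\<close>, for every \<open>k\<close>.\<close>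

lemma r_small_ell:
  assumes "e > 0"
  shows "\<exists>N. \<forall>y\<ge>N. r y \<le> e * ell y"
proof -
  define k where "k = nat \<lceil>4 / e\<rceil>"
  have "real k \<ge> 4 / e" unfolding k_def by linarith
  then have k: "real k * e \<ge> 4" using assms by (simp add: pos_divide_le_eq)
  obtain N where N: "\<And>m. m \<ge> N \<Longrightarrow> r m > 0"
     "\<And>m m'. m \<ge> N \<Longrightarrow> real m \<le> 2^k * real m' \<Longrightarrow> real m' \<le> 2^k * real m \<Longrightarrow> \<bar>r m' - r m\<bar> \<le> 1/2 * r m"
    by (rule slowly_varying_seqE[OF slowly_varying_seq_r, of "2^k" "1/2"]) (simp, simp, blast)
  show ?thesis
  proof (intro exI[of _ "max 1 N"] allI impI)
    fix y assume y: "y \<ge> max 1 N"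
    have ry: "r y > 0" using N y by auto
    have "r y / 2 * (real k / 2) \<le> r y / 2 * (\<Sum>m=Suc y..2^k*y. 1 / real m)"
      using harmonic_dyadic[of y k] y ry by (intro mult_left_mono) auto
    also have "\<dots> = (\<Sum>m=Suc y..2^k*y. r y / 2 * (1 / real m))" by (simp add: sum_distrib_left)
    also have "\<dots> \<le> (\<Sum>m=Suc y..2^k*y. real m * p m)"
    proof (intro sum_mono)
      fix m assume m: "m \<in> {Suc y..2^k*y}"
      have "real m \<le> real (2^k*y)" using m by (intro of_nat_mono) auto
      then have m2: "real m \<le> 2^k * real y" by simp
      have "1 * real m \<le> 2 ^ k * real m" by (intro mult_right_mono) auto
      moreover have "real y \<le> 1 * real m" using m by simp
      ultimately have "real y \<le> 2^k * real m" by (rule order_trans[rotated])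
      then have "\<bar>r m - r y\<bar> \<le> 1/2 * r y" using N(2)[of y m] m2 y by auto
      then have "r y / 2 \<le> r m" by linarith
      then have "r y / 2 * (1 / real m) \<le> r m * (1 / real m)" by (intro mult_right_mono) auto
      also have "\<dots> = real m * p m" using m by (simp add: r_def power2_eq_square)
      finally show "r y / 2 * (1 / real m) \<le> real m * p m" .
    qed
    also have "\<dots> \<le> ell y" by (rule ell_ge_sum)
    finally have "r y * real k \<le> 4 * ell y" by simp
    then have "r y * real k * e \<le> 4 * ell y * e" using assms by (intro mult_right_mono) auto
    moreover have "r y * 4 \<le> r y * (real k * e)" using k ry by (intro mult_left_mono) auto
    ultimately show "r y \<le> e * ell y" by (simp add: mult_ac)
  qed
qed

text \<open>Apart from the step \<open>-1\<close>, the truncated second moment is the sum of \<open>r\<close> up to \<open>y\<close>, hence of order \<open>y * r y\<close>. This is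
  negligible compared to \<open>y * ell y\<close>, so that in an exponential moment with a tilt of order
  \<open>1 / y\<close> the quadratic term is dominated by the linear one.\<close>

lemma truncated_second_moment_small:
  assumes e: "e > 0"
  shows "\<exists>N. \<forall>y\<ge>N. second_moment_upto y \<le> e * real y * ell y"
proof -
  obtain N where N: "N \<ge> 1" "\<And>m. m \<ge> N \<Longrightarrow> r m > 0" "\<And>y. y \<ge> N \<Longrightarrow> (\<Sum>i=N..y. r i) \<le> 10 * real y * r y"
    using slowly_varying_seq_growth[OF slowly_varying_seq_r] by blast
  \<comment> \<open>\<open>c\<close> absorbs the contribution of the steps below \<open>N\<close>, including the step \<open>-1\<close>, into the main sum\<close>
  define c where "c = (1 + (\<Sum>m=1..<N. r m)) / r N"
  have rnn: "r m \<ge> 0" for m by (simp add: r_def p_nonneg)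
  have c: "c \<ge> 0" "1 + (\<Sum>m=1..<N. r m) = c * r N" using N(2)[of N] rnn
    by (auto simp: c_def intro!: divide_nonneg_nonneg add_nonneg_nonneg sum_nonneg)
  define d where "d = e / (10 * (c + 1))"
  have d: "d > 0" "10 * (c + 1) * d = e" using e c by (auto simp: d_def)
  obtain N' where N': "\<And>y. y \<ge> N' \<Longrightarrow> r y \<le> d * ell y" using r_small_ell[OF d(1)] by blast
  have veq: "second_moment_upto y \<le> 1 + (\<Sum>m=1..y. r m)" for y
  proof -
    have "second_moment_upto y = (\<Sum>x\<in>{-1..int y}. pmf q x * (real_of_int x)\<^sup>2)"
      unfolding second_moment_upto_def using skip_free
      by (subst integral_measure_pmf[where A = "{-1..int y}"]) (auto split: if_splits)
    also have "{-1..int y} = {-1, 0} \<union> int ` {1..y}"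
    proof (intro equalityI subsetI)
      fix x assume "x \<in> {-1..int y}"
      then show "x \<in> {-1, 0} \<union> int ` {1..y}"
        by (cases "x \<ge> 1") (auto intro!: image_eqI[of _ _ "nat x"])
    qed auto
    also have "(\<Sum>x\<in>{-1, 0} \<union> int ` {1..y}. pmf q x * (real_of_int x)\<^sup>2) = pmf q (-1) + (\<Sum>m=1..y. r m)"
      by (subst sum.union_disjoint) (auto simp: sum.reindex r_def p_def mult.commute)
    finally show ?thesis using pmf_le_1[of q "-1"] by linarith
  qed
  show ?thesis
  proof (intro exI[of _ "max N N'"] allI impI)
    fix y assume y: "y \<ge> max N N'"
    have "{1..y} = {1..<N} \<union> {N..y}" using y N(1) by auto
    then have "(\<Sum>m=1..y. r m) = sum r ({1..<N} \<union> {N..y})" by (rule arg_cong)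
    also have "\<dots> = (\<Sum>m=1..<N. r m) + (\<Sum>m=N..y. r m)"
      by (rule sum.union_disjoint) auto
    finally have "(\<Sum>m=1..y. r m) = (\<Sum>m=1..<N. r m) + (\<Sum>m=N..y. r m)" .
    moreover have "r N \<le> (\<Sum>m=N..y. r m)" using y rnn by (intro member_le_sum) auto
    then have "c * r N \<le> c * (\<Sum>m=N..y. r m)" using c by (intro mult_left_mono) auto
    ultimately have "second_moment_upto y \<le> (c + 1) * (\<Sum>m=N..y. r m)"
      using veq[of y] c by (simp add: algebra_simps)
    also have "\<dots> \<le> (c + 1) * (10 * real y * r y)" using N(3) y c by (intro mult_left_mono) auto
    also have "\<dots> \<le> (c + 1) * (10 * real y * (d * ell y))" using N' y c by (intro mult_left_mono) auto
    also have "\<dots> = (10 * (c + 1) * d) * real y * ell y" by (simp add: mult_ac)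
    finally show "second_moment_upto y \<le> e * real y * ell y" using d by simp
  qed
qed

text \<open>Steps between \<open>c * b\<close> and \<open>K * b\<close> have probability of order \<open>r b / b\<close>, which is small
  compared to \<open>ell b / b\<close>; steps beyond \<open>K * b\<close> have probability at most \<open>ell b / (K * b)\<close>, and \<open>K\<close>
  is arbitrary.\<close>

lemma tail_prob_small:
  assumes c: "c > 0" and e: "e > 0"
  shows "\<exists>N. \<forall>b\<ge>N. real b * measure_pmf.prob q {x. real_of_int x > c * real b} \<le> e * ell b"
proof -
  define K where "K = nat \<lceil>2/e\<rceil> + nat \<lceil>1 / c\<rceil> + 1"
  have K: "2 / e \<le> real K" "1 / c \<le> real K" "K \<ge> 1" unfolding K_def by linarith+
  have Ke: "1 / real K \<le> e / 2" using K(1,3) e by (simp add: field_simps)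
  have Kc: "1 \<le> real K * c" using K(2) c by (simp add: field_simps)
  define d where "d = e * c\<^sup>2 / (4 * real K)"
  have d: "d > 0" using e c K by (simp add: d_def)
  obtain N1 where N1: "\<And>y. y \<ge> N1 \<Longrightarrow> r y \<le> d * ell y" using r_small_ell[OF d] by blast
  obtain N where N: "\<And>m. m \<ge> N \<Longrightarrow> r m > 0"
     "\<And>m m'. m \<ge> N \<Longrightarrow> real m \<le> real K * real m' \<Longrightarrow> real m' \<le> real K * real m \<Longrightarrow> \<bar>r m' - r m\<bar> \<le> 1 * r m"
    by (rule slowly_varying_seqE[OF slowly_varying_seq_r, of "real K" 1]) (use K(3) in simp, simp, blast)
  show ?thesis
  proof (intro exI[of _ "N1 + N + 1"] allI impI)
    fix b assume b: "b \<ge> N1 + N + 1"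
    have b0: "real b > 0" using b by simp
    let ?S = "{m. c * real b < real m \<and> m \<le> K * b}"
    have fS: "finite ?S" by (rule finite_subset[of _ "{..K*b}"]) auto
    have sub: "{x. real_of_int x > c * real b} \<subseteq> int ` ?S \<union> {x. x > int (K * b)}"
    proof
      fix x assume x: "x \<in> {x. real_of_int x > c * real b}"
      moreover have "c * real b > 0" using c b0 by simp
      ultimately have "real_of_int x > 0" by simp
      then show "x \<in> int ` ?S \<union> {x. x > int (K * b)}" using x
        by (cases "x \<le> int (K * b)") (auto intro!: image_eqI[of _ _ "nat x"] simp: nat_le_iff)
    qed
    have S1: "measure_pmf.prob q (int ` ?S) \<le> 2 * real K * r b / (c\<^sup>2 * real b)"
    proof -
      have "measure_pmf.prob q (int ` ?S) = (\<Sum>m\<in>?S. p m)"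
        using fS by (subst measure_measure_pmf_finite) (auto simp: sum.reindex p_def)
      also have "\<dots> \<le> (\<Sum>m\<in>?S. 2 * r b / (c * real b)\<^sup>2)"
      proof (intro sum_mono)
        fix m assume m: "m \<in> ?S"
        have "real m \<le> real (K * b)" using m by (intro of_nat_mono) auto
        then have m1: "real m \<le> real K * real b" by simp
        have "1 * real b \<le> (real K * c) * real b" using Kc by (intro mult_right_mono) auto
        also have "\<dots> \<le> real K * real m" using m K by (simp add: mult.assoc mult_left_mono)
        finally have "\<bar>r m - r b\<bar> \<le> 1 * r b" using N(2)[of b m] m1 b by auto
        then have "r m \<le> 2 * r b" by linarith
        moreover have "(c * real b)\<^sup>2 \<le> (real m)\<^sup>2" using m c by (intro power_mono) auto
        moreover have "c * real b > 0" using c b0 by simp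
        moreover have "real m > 0" using m calculation(3) by auto
        ultimately show "p m \<le> 2 * r b / (c * real b)\<^sup>2"
          using N(1)[of b] b by (subst p_eq) (auto intro!: frac_le)
      qed
      also have "\<dots> = real (card ?S) * (2 * r b / (c * real b)\<^sup>2)" by simp
      also have "\<dots> \<le> real (K * b) * (2 * r b / (c * real b)\<^sup>2)"
      proof (intro mult_right_mono)
        have "c * real b > 0" using c b0 by simp
        then have "?S \<subseteq> {1..K*b}" by (auto simp: Suc_le_eq intro!: Nat.gr0I)
        then have "card ?S \<le> card {1..K*b}" by (intro card_mono) auto
        then show "real (card ?S) \<le> real (K * b)" by (simp del: of_nat_mult)
      qed (use N(1)[of b] b in auto)
      also have "\<dots> = 2 * real K * r b / (c\<^sup>2 * real b)" using b0 by (simp add: power2_eq_square field_simps)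
      finally show ?thesis .
    qed
    have S2: "measure_pmf.prob q {x. x > int (K * b)} \<le> ell b / real (K * b)"
    proof -
      have "measure_pmf.prob q {x. x > int (K * b)} = measure_pmf.expectation q (indicator {x. x > int (K * b)})"
        by simp
      also have "\<dots> \<le> measure_pmf.expectation q (\<lambda>x. (if x > int b then real_of_int x else 0) / real (K * b))"
      proof (intro integral_mono)
        fix x :: int
        have Kb: "int b \<le> int (K * b)" using K(3) by (intro of_nat_mono) simp
        have pos: "real (K * b) > 0" using K(3) b0 by simp
        show "indicator {x. x > int (K * b)} x \<le> (if x > int b then real_of_int x else 0) / real (K * b)"
        proof (cases "x > int (K * b)")
          case True
          then have "x > int b" "real_of_int x \<ge> real (K * b)" using Kb by linarith+
          then show ?thesis using True pos by (simp add: le_divide_eq del: of_nat_mult)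
        qed (use pos in auto)
      qed (auto intro!: integrable_tail integrable_real_indicator Bochner_Integration.integrable_divide simp del: of_nat_mult
              simp: measure_pmf.emeasure_eq_measure)
      also have "\<dots> = ell b / real (K * b)" by (simp add: ell_def)
      finally show ?thesis .
    qed
    have "measure_pmf.prob q {x. real_of_int x > c * real b} \<le> measure_pmf.prob q (int ` ?S \<union> {x. x > int (K * b)})"
      by (intro measure_pmf.finite_measure_mono sub) simp
    also have "\<dots> \<le> measure_pmf.prob q (int ` ?S) + measure_pmf.prob q {x. x > int (K * b)}"
      by (intro measure_Un_le) auto
    finally have "real b * measure_pmf.prob q {x. real_of_int x > c * real b}
        \<le> real b * (2 * real K * r b / (c\<^sup>2 * real b) + ell b / real (K * b))"
      using S1 S2 by (intro mult_left_mono) auto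
    also have "\<dots> = 2 * real K * r b / c\<^sup>2 + ell b * (1 / real K)" using b0 K by (simp add: field_simps)
    also have "2 * real K * r b / c\<^sup>2 \<le> 2 * real K * (d * ell b) / c\<^sup>2"
      using N1[of b] b by (intro divide_right_mono mult_left_mono) auto
    also have "\<dots> = e / 2 * ell b" using c K by (simp add: d_def)
    also have "ell b * (1 / real K) \<le> ell b * (e / 2)" using Ke ell_nonneg by (intro mult_left_mono) auto
    finally show "real b * measure_pmf.prob q {x. real_of_int x > c * real b} \<le> e * ell b" by simp
  qed
qed

end

section \<open>Exponential bounds for truncated walks\<close>

definition psum :: "(nat \<Rightarrow> int) \<Rightarrow> nat \<Rightarrow> int" where
  "psum x i = (\<Sum>j=1..i. x j)"

lemma psum_0 [simp]: "psum x 0 = 0" and psum_Suc [simp]: "psum x (Suc i) = psum x i + x (Suc i)"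
  by (simp_all add: psum_def)

text \<open>The joint law of \<open>n\<close> independent steps, numbered from \<open>1\<close> as in a path
  \<open>(w\<^sub>0, \<dots>, w\<^sub>n)\<close>; coordinates outside \<open>{1..n}\<close> are set to \<open>0\<close>.\<close>

definition steps :: "int pmf \<Rightarrow> nat \<Rightarrow> (nat \<Rightarrow> int) pmf" where
  "steps q n = Pi_pmf {1..n} 0 (\<lambda>_. q)"

lemma exp_le_quadratic:
  assumes "\<bar>z\<bar> \<le> (k::real)"
  shows "exp z \<le> 1 + z + z\<^sup>2 * exp k"
proof -
  obtain t where t: "\<bar>t\<bar> \<le> \<bar>z\<bar>" "exp z = (\<Sum>m<2. z ^ m / fact m) + exp t / fact 2 * z ^ 2"
    using Maclaurin_exp_le[of z 2] by blast
  have "exp t \<le> exp k" using t(1) assms by simp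
  then have "exp t / 2 \<le> exp k" using exp_gt_zero[of k] by linarith
  then have "exp t / 2 * z\<^sup>2 \<le> exp k * z\<^sup>2" by (intro mult_right_mono) auto
  then show ?thesis using t(2) by (simp add: eval_nat_numeral mult.commute)
qed

lemma steps_component: "j \<in> {1..n} \<Longrightarrow> measure_pmf.prob (steps q n) {x. x j \<in> A} = measure_pmf.prob q A"
proof -
  assume j: "j \<in> {1..n}"
  have "measure_pmf.prob q A = measure_pmf.prob (map_pmf (\<lambda>f. f j) (steps q n)) A"
    using j unfolding steps_def by (subst Pi_pmf_component) auto
  also have "\<dots> = measure_pmf.prob (steps q n) {x. x j \<in> A}"
    by (simp add: vimage_def)
  finally show ?thesis by simp
qed

context cauchy_step
begin

text \<open>Second order expansion of the exponential on the range where the exponent is at most \<open>k\<close>;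
  the first order term is the truncated mean \<open>- ell y\<close>. The tilt \<open>l\<close> may have either sign.\<close>

lemma truncated_mgf_le:
  assumes "\<bar>l\<bar> * real y \<le> k" "y \<ge> 1"
  shows "measure_pmf.expectation q (\<lambda>x. if x \<le> int y then exp (l * real_of_int x) else 0)
    \<le> exp (- l * ell y + l\<^sup>2 * exp k * second_moment_upto y)"
proof -
  have "measure_pmf.expectation q (\<lambda>x. if x \<le> int y then exp (l * real_of_int x) else 0) \<le>
     measure_pmf.expectation q (\<lambda>x. 1 + l * (if x \<le> int y then real_of_int x else 0)
        + l\<^sup>2 * exp k * (if x \<le> int y then (real_of_int x)\<^sup>2 else 0))"
  proof (intro integral_mono_AE integrable_trunc Bochner_Integration.integrable_add
      integrable_mult_right AE_pmfI)
    fix x assume "x \<in> set_pmf q"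
    then have x: "x \<ge> -1" by (rule skip_free)
    show "(if x \<le> int y then exp (l * real_of_int x) else 0) \<le> 1 + l * (if x \<le> int y then real_of_int x else 0)
        + l\<^sup>2 * exp k * (if x \<le> int y then (real_of_int x)\<^sup>2 else 0)"
    proof (cases "x \<le> int y")
      case True
      then have "\<bar>real_of_int x\<bar> \<le> real y" using x assms(2) by (auto simp: abs_le_iff)
      then have "\<bar>l\<bar> * \<bar>real_of_int x\<bar> \<le> \<bar>l\<bar> * real y" by (intro mult_left_mono) auto
      then have "\<bar>l * real_of_int x\<bar> \<le> k" using assms(1) by (simp add: abs_mult)
      from exp_le_quadratic[OF this] show ?thesis using True by (simp add: power_mult_distrib mult_ac)
    qed auto
  qed auto
  also have "\<dots> = 1 + l * (- ell y) + l\<^sup>2 * exp k * second_moment_upto y"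
    unfolding second_moment_upto_def truncated_mean[symmetric]
    by (subst Bochner_Integration.integral_add Bochner_Integration.integrable_add | intro integrable_trunc
        Bochner_Integration.integrable_add integrable_mult_right | simp)+
  also have "\<dots> \<le> exp (- l * ell y + l\<^sup>2 * exp k * second_moment_upto y)"
    using exp_ge_add_one_self[of "- l * ell y + l\<^sup>2 * exp k * second_moment_upto y"] by (simp add: algebra_simps)
  finally show ?thesis .
qed

text \<open>Markov's inequality for the product of the truncated exponentials.\<close>

lemma truncated_walk_chernoff:
  assumes "\<bar>l\<bar> * real y \<le> k" "y \<ge> 1"
  shows "measure_pmf.prob (steps q m) {x. (\<forall>j\<in>{1..m}. x j \<le> int y) \<and> a \<le> l * real_of_int (psum x m)}
    \<le> exp (- a + real m * (- l * ell y + l\<^sup>2 * exp k * second_moment_upto y))"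
proof -
  let ?A = "{x. (\<forall>j\<in>{1..m}. x j \<le> int y) \<and> a \<le> l * real_of_int (psum x m)}"
  define g where "g x = (if x \<le> int y then exp (l * real_of_int x) else 0)" for x
  have g: "integrable (measure_pmf q) g" unfolding g_def by (rule integrable_trunc)
  have g0: "g x \<ge> 0" for x by (simp add: g_def)
  have "measure_pmf.prob (steps q m) ?A = measure_pmf.expectation (steps q m) (indicator ?A)"
    by simp
  also have "\<dots> \<le> measure_pmf.expectation (steps q m) (\<lambda>x. exp (-a) * (\<Prod>j\<in>{1..m}. g (x j)))"
  proof (rule integral_mono)
    show "integrable (measure_pmf (steps q m)) (\<lambda>x. exp (-a) * (\<Prod>j\<in>{1..m}. g (x j)))"
      unfolding steps_def using g by (intro integrable_mult_right integrable_prod_Pi_pmf) auto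
    show "integrable (measure_pmf (steps q m)) (indicator ?A :: _ \<Rightarrow> real)"
      by (intro integrable_real_indicator) (auto simp: measure_pmf.emeasure_eq_measure)
    fix x
    show "indicator ?A x \<le> exp (-a) * (\<Prod>j\<in>{1..m}. g (x j))"
    proof (cases "x \<in> ?A")
      case True
      then have "(\<Prod>j\<in>{1..m}. g (x j)) = (\<Prod>j\<in>{1..m}. exp (l * real_of_int (x j)))"
        by (intro prod.cong) (auto simp: g_def)
      also have "\<dots> = exp (l * real_of_int (psum x m))"
        by (simp add: exp_sum psum_def sum_distrib_left)
      finally have "exp (-a) * (\<Prod>j\<in>{1..m}. g (x j)) = exp (l * real_of_int (psum x m) - a)"
        by (simp add: exp_diff exp_minus field_simps)
      then show ?thesis using True by simp
    qed (auto intro!: mult_nonneg_nonneg prod_nonneg g0)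
  qed
  also have "\<dots> = exp (-a) * (\<Prod>j\<in>{1..m}. measure_pmf.expectation q g)"
    unfolding steps_def using g g0 by (subst integral_mult_right_zero, subst expectation_prod_Pi_pmf) auto
  also have "\<dots> \<le> exp (-a) * (\<Prod>j\<in>{1..m}. exp (- l * ell y + l\<^sup>2 * exp k * second_moment_upto y))"
    using truncated_mgf_le[OF assms] g0 unfolding g_def[symmetric]
    by (intro mult_left_mono prod_mono) (auto simp: Bochner_Integration.integral_nonneg)
  also have "\<dots> = exp (- a + real m * (- l * ell y + l\<^sup>2 * exp k * second_moment_upto y))"
    by (simp only: exp_add exp_of_nat_mult prod_constant) simp
  finally show ?thesis .
qed

section \<open>The scale of the drift\<close>

lemma r_eventually_pos: "\<exists>N\<ge>1. \<forall>m\<ge>N. r m > 0"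
  using slowly_varying_seq_growth[OF slowly_varying_seq_r] by blast

lemma ell_pos: "ell y > 0"
proof -
  obtain N where N: "N \<ge> 1" "\<And>m. m \<ge> N \<Longrightarrow> r m > 0" using r_eventually_pos by blast
  define z where "z = y + N"
  have "r (Suc z) > 0" using N z_def by auto
  then have "real (Suc z) * p (Suc z) > 0" by (auto simp: r_def power2_eq_square zero_less_mult_iff)
  then have "ell z > 0" using ell_Suc[of z] ell_nonneg[of "Suc z"] by linarith
  then show ?thesis using ell_antimono[of y z] by (simp add: z_def)
qed

text \<open>The scale \<open>b\<^sub>n\<close> with \<open>b\<^sub>n \<approx> n * ell b\<^sub>n\<close>: a walk of \<open>n\<close> steps none of which exceeds
  \<open>b\<^sub>n\<close> typically ends near \<open>- b\<^sub>n\<close>. Taking the largest \<open>b\<close> with \<open>b \<le> n * ell b\<close> gives the lower bound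
  \<open>n * ell y \<ge> b\<^sub>n\<close> for all \<open>y \<le> b\<^sub>n\<close> at once.\<close>

definition scale :: "nat \<Rightarrow> nat" where
  "scale n = Max {b. real b \<le> real n * ell b}"

lemma finite_scale_set: "finite {b. real b \<le> real n * ell b}"
proof (rule finite_subset)
  show "{b. real b \<le> real n * ell b} \<subseteq> {..nat \<lceil>real n * ell 0\<rceil>}"
  proof
    fix b assume "b \<in> {b. real b \<le> real n * ell b}"
    then have "real b \<le> real n * ell b" by simp
    also have "\<dots> \<le> real n * ell 0" by (intro mult_left_mono ell_antimono) auto
    finally show "b \<in> {..nat \<lceil>real n * ell 0\<rceil>}" by simp linarith
  qed
qed simp

lemma scale_le: "real (scale n) \<le> real n * ell (scale n)"
proof -
  have "scale n \<in> {b. real b \<le> real n * ell b}"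
    unfolding scale_def using ell_nonneg[of 0]
    by (intro Max_in finite_scale_set) (auto intro!: exI[of _ 0])
  then show ?thesis by simp
qed

lemma scale_ge: "real b \<le> real n * ell b \<Longrightarrow> b \<le> scale n"
  unfolding scale_def by (intro Max_ge finite_scale_set) auto

lemma scale_Suc: "real n * ell (Suc (scale n)) < real (Suc (scale n))"
  using scale_ge[of "Suc (scale n)" n] by (meson Suc_n_not_le_n not_le)

lemma scale_linear: "real (scale n) \<le> real n * ell 0"
  using scale_le[of n] mult_left_mono[OF ell_antimono[of 0 "scale n"], of "real n"] by simp

lemma scale_at_top: "filterlim scale at_top sequentially"
  unfolding filterlim_at_top
proof
  fix B
  show "\<forall>\<^sub>F n in sequentially. B \<le> scale n"
    using eventually_ge_at_top[of "nat \<lceil>real B / ell B\<rceil>"]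
  proof eventually_elim
    case (elim n)
    then have "real B / ell B \<le> real n" by linarith
    then have "real B \<le> real n * ell B" using ell_pos[of B] by (simp add: field_simps)
    then show ?case by (rule scale_ge)
  qed
qed

lemma eventually_scale: "\<forall>\<^sub>F n in sequentially. P (scale n)" if "\<exists>N. \<forall>b\<ge>N. P b"
  using that scale_at_top unfolding eventually_sequentially filterlim_at_top
  by (meson le_trans)

text \<open>By maximality the defining inequality fails at \<open>b\<^sub>n + 1\<close>, and \<open>ell\<close> changes by a
  relatively negligible amount between \<open>b\<^sub>n\<close> and \<open>b\<^sub>n + 1\<close>.\<close>

lemma scale_ell_le:
  assumes "e > 0"
  shows "\<forall>\<^sub>F n in sequentially. real n * ell (scale n) \<le> (1 + e) * real (scale n)"
proof -
  define d where "d = min 1 (e / 3)"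
  have d: "d > 0" "d \<le> 1" "3 * d \<le> e" using assms by (auto simp: d_def)
  obtain N where N: "\<And>y. y \<ge> N \<Longrightarrow> r y \<le> d * ell y" using r_small_ell[OF d(1)] by blast
  have "\<forall>\<^sub>F n in sequentially. scale n \<ge> N + nat \<lceil>1/d\<rceil>"
    by (rule eventually_scale) blast
  then show ?thesis
  proof eventually_elim
    case (elim n)
    define b where "b = scale n"
    have b: "b \<ge> N" "1 / d \<le> real b" using elim unfolding b_def by linarith+
    have b1: "1 \<le> d * real b" using b(2) d by (simp add: field_simps)
    have "real (Suc b) * p (Suc b) = r (Suc b) / real (Suc b)"
      by (simp add: r_def power2_eq_square)
    also have "\<dots> \<le> r (Suc b) / 1" by (intro divide_left_mono) (auto simp: r_def p_nonneg)
    also have "\<dots> \<le> d * ell (Suc b)" using N[of "Suc b"] b by simp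
    finally have "ell b \<le> (1 + d) * ell (Suc b)" using ell_Suc[of b] by (simp add: algebra_simps)
    then have "real n * ell b \<le> real n * ((1 + d) * ell (Suc b))" by (intro mult_left_mono) auto
    also have "\<dots> = (1 + d) * (real n * ell (Suc b))" by simp
    also have "\<dots> \<le> (1 + d) * real (Suc b)" using scale_Suc[of n] d by (intro mult_left_mono) (auto simp: b_def)
    also have "\<dots> \<le> (1 + d) * ((1 + d) * real b)" using b1 d by (intro mult_left_mono) (auto simp: algebra_simps)
    also have "\<dots> = (1 + 2 * d + d * d) * real b" by (simp add: algebra_simps)
    also have "\<dots> \<le> (1 + e) * real b"
    proof (intro mult_right_mono)
      have "d * d \<le> d * 1" using d by (intro mult_left_mono) auto
      then show "1 + 2 * d + d * d \<le> 1 + e" using d by linarith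
    qed simp
    finally show ?case by (simp add: b_def)
  qed
qed

section \<open>Deviations of the walk\<close>

text \<open>If all steps are at most \<open>y \<le> b\<^sub>n\<close>, the drift \<open>- n * ell y\<close> is at most \<open>- b\<^sub>n\<close>. Ending above
  \<open>- (1 - d) * b\<^sub>n\<close> costs \<open>exp (- k * d / 2 * b\<^sub>n / y)\<close> by tilting with \<open>k / y\<close>. The strength
  \<open>k\<close> of the tilt is free; only the threshold \<open>Y\<close> and the range of \<open>n\<close> depend on it.\<close>

lemma upper_deviation:
  assumes d: "0 < d" "d < 1" and k: "k > 0"
  shows "\<exists>Y\<ge>1. \<forall>\<^sub>F n in sequentially. \<forall>y. Y \<le> y \<longrightarrow> y \<le> scale n \<longrightarrow>
    measure_pmf.prob (steps q (n - 1))
      {x. (\<forall>j\<in>{1..n-1}. x j \<le> int y) \<and> real_of_int (psum x (n-1)) \<ge> - (1 - d) * real (scale n) - 1}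
    \<le> exp (- (k * d / 2) * (real (scale n) / real y))"
proof -
  \<comment> \<open>makes the quadratic term at most a fraction \<open>d / 4\<close> of the drift\<close>
  define e where "e = d / (4 * k * exp k)"
  have e: "e > 0" "k * exp k * e = d / 4" using d k by (auto simp: e_def)
  obtain Y0 where Y0: "\<And>y. y \<ge> Y0 \<Longrightarrow> second_moment_upto y \<le> e * real y * ell y" using truncated_second_moment_small[OF e(1)] by blast
  define Y where "Y = max 1 Y0"
  have ev1: "\<forall>\<^sub>F n in sequentially. scale n \<ge> nat \<lceil>8/d\<rceil>"
    by (rule eventually_scale) blast
  have ev2: "\<forall>\<^sub>F n in sequentially. n \<ge> nat \<lceil>8/d\<rceil>"
    by (rule eventually_ge_at_top)
  have "\<forall>\<^sub>F n in sequentially. \<forall>y. Y \<le> y \<longrightarrow> y \<le> scale n \<longrightarrow>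
    measure_pmf.prob (steps q (n - 1))
      {x. (\<forall>j\<in>{1..n-1}. x j \<le> int y) \<and> real_of_int (psum x (n-1)) \<ge> - (1 - d) * real (scale n) - 1}
    \<le> exp (- (k * d / 2) * (real (scale n) / real y))"
    using ev1 ev2
  proof eventually_elim
    case (elim n)
    define b where "b = scale n"
    have "8 / d \<le> real b" "8 / d \<le> real n" using elim unfolding b_def by linarith+
    then have b: "8 \<le> d * real b" "8 \<le> d * real n" using d by (auto simp: field_simps)
    have n1: "real n > 0" using b d by (cases n) auto
    then have rn: "real (n - 1) = real n - 1" by (cases n) auto
    have nb: "(1 - d / 8) * real n \<le> real (n - 1)" using b rn by (simp add: algebra_simps)
    show ?case
    proof (intro allI impI)
      fix y assume y: "Y \<le> y" "y \<le> scale n"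
      have y1: "y \<ge> 1" "real y > 0" "y \<ge> Y0" using y by (auto simp: Y_def)
      define l where "l = k / real y"
      have l: "l > 0" using k y1 by (simp add: l_def)
      have ly: "\<bar>l\<bar> * real y \<le> k" using k y1 by (simp add: l_def)
      have q: "l\<^sup>2 * exp k * second_moment_upto y \<le> l * (d / 4) * ell y"
      proof -
        have "l\<^sup>2 * exp k * second_moment_upto y \<le> l\<^sup>2 * exp k * (e * real y * ell y)"
          using Y0[OF y1(3)] by (intro mult_left_mono) auto
        also have "\<dots> = l * (k * exp k * e) * ell y" using y1 by (simp add: l_def power2_eq_square)
        finally show ?thesis by (simp add: e)
      qed
      have "real b \<le> real n * ell y"
        using scale_le[of n] ell_antimono[of y b] y n1 mult_left_mono[of "ell b" "ell y" "real n"]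
        unfolding b_def by linarith
      then have "(1 - d / 8) * real b \<le> (1 - d / 8) * (real n * ell y)" using d by (intro mult_left_mono) auto
      also have "\<dots> = ((1 - d / 8) * real n) * ell y" by simp
      also have "\<dots> \<le> real (n - 1) * ell y" using nb ell_nonneg by (intro mult_right_mono) auto
      finally have B: "(1 - d / 8) * real b \<le> real (n - 1) * ell y" .
      define a where "a = l * (- (1 - d) * real b - 1)"
      have "measure_pmf.prob (steps q (n - 1))
          {x. (\<forall>j\<in>{1..n-1}. x j \<le> int y) \<and> real_of_int (psum x (n-1)) \<ge> - (1 - d) * real b - 1}
        \<le> measure_pmf.prob (steps q (n - 1)) {x. (\<forall>j\<in>{1..n-1}. x j \<le> int y) \<and> a \<le> l * real_of_int (psum x (n-1))}"
        using l by (intro measure_pmf.finite_measure_mono) (auto simp: a_def)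
      also have "\<dots> \<le> exp (- a + real (n - 1) * (- l * ell y + l\<^sup>2 * exp k * second_moment_upto y))"
        by (rule truncated_walk_chernoff[OF ly y1(1)])
      also have "- a + real (n - 1) * (- l * ell y + l\<^sup>2 * exp k * second_moment_upto y) \<le> - (l * (d / 2) * real b)"
      proof -
        have "real (n - 1) * (- l * ell y + l\<^sup>2 * exp k * second_moment_upto y) \<le> real (n - 1) * (- l * ell y + l * (d / 4) * ell y)"
          using q by (intro mult_left_mono) auto
        also have "\<dots> = - (l * (1 - d / 4)) * (real (n - 1) * ell y)" by (simp add: algebra_simps)
        also have "\<dots> \<le> - (l * (1 - d / 4)) * ((1 - d / 8) * real b)"
          using B l d by (intro mult_left_mono_neg) auto
        finally have "real (n - 1) * (- l * ell y + l\<^sup>2 * exp k * second_moment_upto y)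
            \<le> - (l * (1 - d / 4)) * ((1 - d / 8) * real b)" .
        moreover have "l * ((1 - d) * real b + 1 - (1 - d / 4) * ((1 - d / 8) * real b))
            = - a + - (l * (1 - d / 4)) * ((1 - d / 8) * real b)"
          by (simp add: a_def field_simps)
        ultimately have "- a + real (n - 1) * (- l * ell y + l\<^sup>2 * exp k * second_moment_upto y)
            \<le> l * ((1 - d) * real b + 1 - (1 - d / 4) * ((1 - d / 8) * real b))"
          by linarith
        also have "\<dots> \<le> l * (- (d / 2) * real b)"
        proof (intro mult_left_mono)
          have "(1 - d / 4) * (1 - d / 8) \<ge> 1 - 3 * d / 8" using d by (simp add: algebra_simps)
          then have "(1 - d / 4) * (1 - d / 8) * real b \<ge> (1 - 3 * d / 8) * real b" by (rule mult_right_mono) simp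
          moreover have eq: "(1 - 3 * d / 8) * real b = real b - 3 / 8 * (d * real b)"
            by (simp add: left_diff_distrib)
          ultimately have X: "(1 - d / 4) * ((1 - d / 8) * real b) \<ge> real b - 3 / 8 * (d * real b)"
            unfolding eq mult.assoc[of "1 - d / 4"] by simp
          have "(1 - d) * real b + 1 - (1 - d / 4) * ((1 - d / 8) * real b) \<le> - 1 / 2 * (d * real b)"
            using X b(1) unfolding left_diff_distrib[of 1 d "real b"] mult_1 by linarith
          then show "(1 - d) * real b + 1 - (1 - d / 4) * ((1 - d / 8) * real b) \<le> - (d / 2) * real b"
            by simp
        qed (use l in simp)
        finally show ?thesis by simp
      qed
      also have "- (l * (d / 2) * real b) = - (k * d / 2) * (real b / real y)" by (simp add: l_def)
      finally show "measure_pmf.prob (steps q (n - 1))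
          {x. (\<forall>j\<in>{1..n-1}. x j \<le> int y) \<and> real_of_int (psum x (n-1)) \<ge> - (1 - d) * real (scale n) - 1}
        \<le> exp (- (k * d / 2) * (real (scale n) / real y))" by (simp add: b_def)
    qed
  qed
  moreover have "Y \<ge> 1" by (simp add: Y_def)
  ultimately show ?thesis by blast
qed

text \<open>The reverse estimate, at the level \<open>b\<^sub>n\<close> only, by tilting with \<open>- k / b\<^sub>n\<close>.\<close>

lemma lower_deviation:
  assumes d: "0 < d" "d < 1" and k: "k > 0"
  shows "\<forall>\<^sub>F n in sequentially. 
    measure_pmf.prob (steps q (n - 1))
      {x. (\<forall>j\<in>{1..n-1}. x j \<le> int (scale n)) \<and> real_of_int (psum x (n-1)) \<le> - (1 + d) * real (scale n)}
    \<le> exp (- (k * d / 2))"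
proof -
  define e where "e = d / (8 * k * exp k)"
  have e: "e > 0" "k * exp k * e = d / 8" using d k by (auto simp: e_def)
  have ev1: "\<forall>\<^sub>F n in sequentially. second_moment_upto (scale n) \<le> e * real (scale n) * ell (scale n)"
    by (rule eventually_scale) (rule truncated_second_moment_small[OF e(1)])
  have ev2: "\<forall>\<^sub>F n in sequentially. scale n \<ge> 1"
    by (rule eventually_scale) blast
  have ev3: "\<forall>\<^sub>F n in sequentially. real n * ell (scale n) \<le> (1 + d / 8) * real (scale n)"
    using d by (intro scale_ell_le) auto
  show ?thesis
    using ev1 ev2 ev3
  proof eventually_elim
    case (elim n)
    define b where "b = scale n"
    note el = elim[folded b_def]
    have b1: "real b > 0" using el by simp
    define l where "l = - k / real b"
    have lb: "\<bar>l\<bar> * real b \<le> k" using k b1 by (simp add: l_def abs_divide)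
    have q: "l\<^sup>2 * exp k * second_moment_upto b \<le> (k / real b) * (d / 8) * ell b"
    proof -
      have "l\<^sup>2 * exp k * second_moment_upto b \<le> l\<^sup>2 * exp k * (e * real b * ell b)"
        using el(1) by (intro mult_left_mono) auto
      also have "\<dots> = (k / real b) * (k * exp k * e) * ell b" using b1 by (simp add: l_def power2_eq_square)
      finally show ?thesis by (simp add: e)
    qed
    have "measure_pmf.prob (steps q (n - 1))
        {x. (\<forall>j\<in>{1..n-1}. x j \<le> int b) \<and> real_of_int (psum x (n-1)) \<le> - (1 + d) * real b}
      \<le> measure_pmf.prob (steps q (n - 1)) {x. (\<forall>j\<in>{1..n-1}. x j \<le> int b) \<and> k * (1 + d) \<le> l * real_of_int (psum x (n-1))}"
    proof (intro measure_pmf.finite_measure_mono)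
      have "k * (1 + d) \<le> l * s" if "s \<le> - (1 + d) * real b" for s
      proof -
        have "(k / real b) * s \<le> (k / real b) * (- (1 + d) * real b)"
          using that k by (intro mult_left_mono) auto
        then show ?thesis using b1 by (simp add: l_def algebra_simps)
      qed
      then show "{x. (\<forall>j\<in>{1..n-1}. x j \<le> int b) \<and> real_of_int (psum x (n-1)) \<le> - (1 + d) * real b}
         \<subseteq> {x. (\<forall>j\<in>{1..n-1}. x j \<le> int b) \<and> k * (1 + d) \<le> l * real_of_int (psum x (n-1))}" by blast
    qed simp
    also have "\<dots> \<le> exp (- (k * (1 + d)) + real (n - 1) * (- l * ell b + l\<^sup>2 * exp k * second_moment_upto b))"
      using el by (intro truncated_walk_chernoff[OF lb]) auto
    also have "- (k * (1 + d)) + real (n - 1) * (- l * ell b + l\<^sup>2 * exp k * second_moment_upto b) \<le> - (k * d / 2)"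
    proof -
      have "real (n - 1) * (- l * ell b + l\<^sup>2 * exp k * second_moment_upto b) \<le> real (n - 1) * ((k / real b) * ell b + (k / real b) * (d / 8) * ell b)"
        using q by (intro mult_left_mono) (auto simp: l_def)
      also have "\<dots> = (k / real b) * (1 + d / 8) * (real (n - 1) * ell b)" by (simp add: algebra_simps)
      also have "\<dots> \<le> (k / real b) * (1 + d / 8) * (real n * ell b)"
        using k d ell_nonneg by (intro mult_left_mono mult_right_mono) auto
      also have "\<dots> \<le> (k / real b) * (1 + d / 8) * ((1 + d / 8) * real b)"
        using k d el(3) by (intro mult_left_mono) auto
      also have "\<dots> = k * ((1 + d / 8) * (1 + d / 8))" using b1 by simp
      also have "\<dots> \<le> k * (1 + d / 2)"
      proof (intro mult_left_mono)
        have "d * d \<le> d * 1" using d by (intro mult_left_mono) auto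
        moreover have "(1 + d / 8) * (1 + d / 8) = 1 + d / 4 + d * d / 64" by (simp add: algebra_simps)
        ultimately show "(1 + d / 8) * (1 + d / 8) \<le> 1 + d / 2" using d by linarith
      qed (use k in simp)
      finally show ?thesis by (simp add: algebra_simps)
    qed
    finally show ?case by (simp add: b_def)
  qed
qed

lemma max_step_small:
  assumes c: "c > 0" and e: "e > 0"
  shows "\<forall>\<^sub>F n in sequentially.
    measure_pmf.prob (steps q (n - 1)) {x. \<exists>j\<in>{1..n-1}. real_of_int (x j) > c * real (scale n)} \<le> e"
proof -
  have ev1: "\<forall>\<^sub>F n in sequentially. real (scale n) * measure_pmf.prob q {x. real_of_int x > c * real (scale n)} \<le> e / 2 * ell (scale n)"
    using c e by (intro eventually_scale[OF tail_prob_small]) auto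
  have ev2: "\<forall>\<^sub>F n in sequentially. scale n \<ge> 1"
    by (rule eventually_scale) blast
  have ev3: "\<forall>\<^sub>F n in sequentially. real n * ell (scale n) \<le> (1 + 1) * real (scale n)"
    by (intro scale_ell_le) auto
  show ?thesis
    using ev1 ev2 ev3
  proof eventually_elim
    case (elim n)
    define b where "b = scale n"
    note el = elim[folded b_def]
    have b1: "real b > 0" using el by simp
    let ?P = "measure_pmf.prob q {x. real_of_int x > c * real b}"
    have un: "{x. \<exists>j\<in>{1..n-1}. real_of_int (x j) > c * real b} = (\<Union>j\<in>{1..n-1}. {x. x j \<in> {x. real_of_int x > c * real b}})"
      by auto
    have "measure_pmf.prob (steps q (n - 1)) {x. \<exists>j\<in>{1..n-1}. real_of_int (x j) > c * real b}
       \<le> (\<Sum>j\<in>{1..n-1}. measure_pmf.prob (steps q (n - 1)) {x. x j \<in> {x. real_of_int x > c * real b}})"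
      unfolding un by (rule measure_UNION_le) auto
    also have "\<dots> = (\<Sum>j\<in>{1..n-1}. ?P)"
      by (intro sum.cong refl steps_component)
    also have "\<dots> = real (n - 1) * ?P" by simp
    also have "\<dots> \<le> real n * ?P" by (intro mult_right_mono) auto
    finally have "real b * measure_pmf.prob (steps q (n - 1)) {x. \<exists>j\<in>{1..n-1}. real_of_int (x j) > c * real b} \<le> real b * (real n * ?P)"
      by (intro mult_left_mono) auto
    also have "\<dots> = real n * (real b * ?P)" by simp
    also have "\<dots> \<le> real n * (e / 2 * ell b)" using el by (intro mult_left_mono) auto
    also have "\<dots> = e / 2 * (real n * ell b)" by simp
    also have "\<dots> \<le> e / 2 * ((1 + 1) * real b)" using el e by (intro mult_left_mono) auto
    also have "\<dots> = real b * e" by simp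
    finally show ?case using b1 by (simp add: b_def)
  qed
qed

text \<open>The typical behaviour of the first \<open>n - 1\<close> steps: the step that closes the path at \<open>-1\<close> lies
  in a window around \<open>b\<^sub>n\<close> and exceeds all the others.\<close>

definition good_steps :: "real \<Rightarrow> nat \<Rightarrow> (nat \<Rightarrow> int) set" where
  "good_steps d n = {x. (\<forall>j\<in>{1..n-1}. real_of_int (x j) \<le> (1 - d) * real (scale n)) \<and>
     real_of_int (- 1 - psum x (n - 1)) > (1 - d) * real (scale n) \<and>
     real_of_int (- 1 - psum x (n - 1)) \<le> (1 + d) * real (scale n)}"

lemma good_steps_likely:
  assumes d: "0 < d" "d < 1" and e: "e > 0"
  shows "\<forall>\<^sub>F n in sequentially. measure_pmf.prob (steps q (n - 1)) (good_steps d n) \<ge> 1 - e"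
proof -
  \<comment> \<open>a tilt for which both deviation bounds are at most \<open>e / 4\<close>\<close>
  define k where "k = 2 / d * \<bar>ln (e / 4)\<bar> + 1"
  have k: "k > 0" using d by (simp add: k_def add_nonneg_pos)
  have ke: "exp (- (k * d / 2)) \<le> e / 4"
  proof -
    have "k * d / 2 = \<bar>ln (e / 4)\<bar> + d / 2" using d by (simp add: k_def field_simps)
    then have "k * d / 2 \<ge> - ln (e / 4)" using d by linarith
    then have "exp (- (k * d / 2)) \<le> exp (ln (e / 4))" by simp
    then show ?thesis using e by simp
  qed
  obtain Y where Y: "\<forall>\<^sub>F n in sequentially. \<forall>y. Y \<le> y \<longrightarrow> y \<le> scale n \<longrightarrow>
    measure_pmf.prob (steps q (n - 1))
      {x. (\<forall>j\<in>{1..n-1}. x j \<le> int y) \<and> real_of_int (psum x (n-1)) \<ge> - (1 - d) * real (scale n) - 1}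
    \<le> exp (- (k * d / 2) * (real (scale n) / real y))"
    using upper_deviation[OF d k] by blast
  have ev: "\<forall>\<^sub>F n in sequentially. scale n \<ge> Y + 1" by (rule eventually_scale) blast
  have ev3: "\<forall>\<^sub>F n in sequentially.
    measure_pmf.prob (steps q (n - 1)) {x. \<exists>j\<in>{1..n-1}. real_of_int (x j) > (1 - d) * real (scale n)} \<le> e / 4"
    using d e by (intro max_step_small) auto
  show ?thesis using Y ev lower_deviation[OF d k] ev3
  proof eventually_elim
    case (elim n)
    define b where "b = scale n"
    note el = elim[folded b_def]
    define A where "A = {x. (\<forall>j\<in>{1..n-1}. x j \<le> int b) \<and> real_of_int (psum x (n-1)) \<ge> - (1 - d) * real b - 1}"
    define B where "B = {x. (\<forall>j\<in>{1..n-1}. x j \<le> int b) \<and> real_of_int (psum x (n-1)) \<le> - (1 + d) * real b}"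
    define C where "C = {x. \<exists>j\<in>{1..n-1}. real_of_int (x j) > (1 - d) * real b}"
    let ?p = "measure_pmf.prob (steps q (n - 1))"
    have "?p A \<le> exp (- (k * d / 2) * (real b / real b))"
      using el(1,2) unfolding A_def by (auto dest: spec[of _ b])
    also have "real b / real b = 1" using el(2) by simp
    finally have pA: "?p A \<le> e / 4" using ke by simp
    have pB: "?p B \<le> e / 4" using el(3) ke unfolding B_def by linarith
    have pC: "?p C \<le> e / 4" using el(4) unfolding C_def by simp
    have "- good_steps d n \<subseteq> A \<union> B \<union> C"
    proof
      fix x assume x: "x \<in> - good_steps d n"
      show "x \<in> A \<union> B \<union> C"
      proof (rule ccontr)
        assume nx: "x \<notin> A \<union> B \<union> C"
        have small: "real_of_int (x j) \<le> (1 - d) * real b" if "j \<in> {1..n-1}" for j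
          using nx that unfolding C_def by force
        have small': "x j \<le> int b" if "j \<in> {1..n-1}" for j
        proof -
          have "(1 - d) * real b \<le> 1 * real b" using d by (intro mult_right_mono) auto
          then show ?thesis using small[OF that] by linarith
        qed
        have "real_of_int (psum x (n-1)) < - (1 - d) * real b - 1" using nx small' unfolding A_def by force
        moreover have "real_of_int (psum x (n-1)) > - (1 + d) * real b" using nx small' unfolding B_def by force
        ultimately have "x \<in> good_steps d n" using small unfolding good_steps_def b_def[symmetric] by (simp add: algebra_simps)
        then show False using x by simp
      qed
    qed
    then have "?p (- good_steps d n) \<le> ?p (A \<union> B \<union> C)" by (intro measure_pmf.finite_measure_mono) auto
    also have "\<dots> \<le> ?p A + ?p B + ?p C"
      using measure_Un_le[of A "measure_pmf (steps q (n - 1))" B] measure_Un_le[of "A \<union> B" "measure_pmf (steps q (n - 1))" C] by simp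
    also have "\<dots> \<le> e" using pA pB pC e by linarith
    finally show ?case
      using measure_pmf.prob_compl[of "good_steps d n" "steps q (n - 1)"] by (simp add: Compl_eq_Diff_UNIV)
  qed
qed

end

section \<open>Closing the path and rotating the steps\<close>

lemma psum_cong: "(\<And>j. j \<in> {1..i} \<Longrightarrow> x j = y j) \<Longrightarrow> psum x i = psum y i"
  unfolding psum_def by (rule sum.cong) auto

lemma integrable_indicator_pmf: "integrable (measure_pmf M) (indicator A :: _ \<Rightarrow> real)"
  by (intro integrable_real_indicator) (auto simp: measure_pmf.emeasure_eq_measure)

lemma steps_split_last:
  assumes "n \<ge> 1"
  shows "steps q n = bind_pmf (steps q (n - 1)) (\<lambda>f. map_pmf (\<lambda>y. f(n := y)) q)"
proof -
  have "{1..n} = insert n {1..n-1}" using assms by auto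
  then have "steps q n = q \<bind> (\<lambda>y. Pi_pmf {1..n-1} 0 (\<lambda>_. q) \<bind> (\<lambda>f. return_pmf (f(n := y))))"
    using assms unfolding steps_def by (simp add: Pi_pmf_insert')
  also have "\<dots> = steps q (n - 1) \<bind> (\<lambda>f. q \<bind> (\<lambda>y. return_pmf (f(n := y))))"
    unfolding steps_def by (rule bind_commute_pmf)
  finally show ?thesis by (simp add: map_pmf_def)
qed

text \<open>Given the first \<open>n - 1\<close> steps, the event that the path ends at \<open>-1\<close> prescribes the last step.\<close>

lemma prob_bridge_last_step:
  assumes n: "n \<ge> 1"
  shows "measure_pmf.prob (steps q n) {x. psum x n = -1 \<and> H x}
    = measure_pmf.expectation (steps q (n - 1))
        (\<lambda>f. pmf q (-1 - psum f (n - 1)) * indicator {f. H (f(n := -1 - psum f (n - 1)))} f)"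
proof -
  let ?g = "\<lambda>f. pmf q (-1 - psum f (n - 1)) * indicator {f. H (f(n := -1 - psum f (n - 1)))} f :: real"
  have last: "psum (f(n := y)) n = psum f (n - 1) + y" for f y
  proof -
    have "psum (f(n := y)) n = psum (f(n := y)) (n - 1) + y" using n by (cases n) auto
    also have "psum (f(n := y)) (n - 1) = psum f (n - 1)" using n by (intro psum_cong) auto
    finally show ?thesis .
  qed
  have "emeasure (map_pmf (\<lambda>y. f(n := y)) q) {x. psum x n = -1 \<and> H x} = ennreal (?g f)" for f
  proof -
    have "(\<lambda>y. f(n := y)) -` {x. psum x n = -1 \<and> H x}
        = (if H (f(n := -1 - psum f (n - 1))) then {-1 - psum f (n - 1)} else {})"
    proof -
      have "psum f (n - 1) + y = -1 \<longleftrightarrow> y = -1 - psum f (n - 1)" for y by auto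
      then show ?thesis by (auto simp: last)
    qed
    then show ?thesis
      by (simp add: measure_pmf.emeasure_eq_measure pmf.rep_eq emeasure_pmf_single)
  qed
  then have "emeasure (steps q n) {x. psum x n = -1 \<and> H x} = (\<integral>\<^sup>+f. ennreal (?g f) \<partial>steps q (n - 1))"
    by (subst steps_split_last[OF n]) (simp only: emeasure_bind_pmf)
  also have "\<dots> = ennreal (measure_pmf.expectation (steps q (n - 1)) ?g)"
  proof (rule nn_integral_eq_integral)
    show "integrable (measure_pmf (steps q (n - 1))) ?g"
      by (rule measure_pmf.integrable_const_bound[where B = 1]) (auto simp: indicator_def pmf_le_1)
  qed (auto simp: indicator_def)
  finally show ?thesis
    by (simp add: measure_pmf.emeasure_eq_measure Bochner_Integration.integral_nonneg)
qed

text \<open>The rotation by \<open>k\<close> of the positions \<open>1, \<dots>, n\<close>; it is the identity elsewhere, so that it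
  permutes the coordinates of a product law.\<close>

definition cyc :: "nat \<Rightarrow> nat \<Rightarrow> nat \<Rightarrow> nat" where
  "cyc n k j = (if j \<in> {1..n} then (k + (j - 1)) mod n + 1 else j)"

lemma cyc_range: "j \<in> {1..n} \<Longrightarrow> cyc n k j \<in> {1..n}"
  by (cases n) (auto simp: cyc_def Suc_le_eq less_Suc_eq_le[symmetric] simp del: mod_less_divisor intro!: mod_less_divisor)

lemma bij_cyc: "bij_betw (cyc n k) {1..n} {1..n}"
proof -
  have "inj_on (cyc n k) {1..n}"
  proof (rule inj_onI)
    fix i j assume ij: "i \<in> {1..n}" "j \<in> {1..n}" "cyc n k i = cyc n k j"
    then have mod: "(k + (i - 1)) mod n = (k + (j - 1)) mod n" by (simp add: cyc_def)
    have "a = b" if "(k + a) mod n = (k + b) mod n" "a \<le> b" "b < n" for a b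
    proof -
      have "n dvd (k + b) - (k + a)" using that by (subst mod_eq_dvd_iff_nat[symmetric]) auto
      then have "n dvd b - a" by simp
      moreover have "b - a < n" using that(3) by simp
      ultimately have "\<not> 0 < b - a" using nat_dvd_not_less by blast
      then show ?thesis using that(2) by simp
    qed
    note eqI = this
    have "i - 1 < n" "j - 1 < n" using ij(1,2) by auto
    then have "i - 1 = j - 1"
      using eqI[OF mod] eqI[OF mod[symmetric]] by linarith
    then show "i = j" using ij by auto
  qed
  moreover have "cyc n k ` {1..n} \<subseteq> {1..n}" using cyc_range by blast
  ultimately show ?thesis
    by (simp add: bij_betw_def endo_inj_surj)
qed

definition rot :: "nat \<Rightarrow> nat \<Rightarrow> (nat \<Rightarrow> int) \<Rightarrow> nat \<Rightarrow> int" where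
  "rot n k x = x \<circ> cyc n k"

lemma steps_rot: "map_pmf (rot n k) (steps q n) = steps q n"
proof -
  have "steps q n = map_pmf (\<lambda>g. g \<circ> cyc n k) (steps q n)"
    unfolding steps_def by (rule Pi_pmf_bij_betw[OF _ bij_cyc]) (simp, simp only: cyc_def if_False not_False_eq_True)
  then show ?thesis by (simp add: rot_def[abs_def])
qed

lemma prob_rot: "measure_pmf.prob (steps q n) {x. rot n k x \<in> A} = measure_pmf.prob (steps q n) A"
proof -
  have "measure_pmf.prob (steps q n) A = measure_pmf.prob (map_pmf (rot n k) (steps q n)) A"
    by (simp add: steps_rot)
  then show ?thesis by (simp add: vimage_def)
qed

lemma psum_rot: "psum (rot n k x) n = psum x n"
  unfolding psum_def rot_def using sum.reindex_bij_betw[OF bij_cyc, of x n k] by simp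

lemma rot_last: "i \<in> {1..n} \<Longrightarrow> rot n i x n = x i"
  by (auto simp: rot_def cyc_def Suc_le_eq) (metis Nat.add_diff_assoc2 Suc_leI Suc_pred One_nat_def add.commute diff_Suc_less less_le_trans mod_add_self2 mod_less)

text \<open>Some step is the largest one, and rotating it to the end does not change the law of the steps
  or their sum.\<close>

lemma bridge_prob_le_max_last:
  assumes n: "n \<ge> 1"
  shows "measure_pmf.prob (steps q n) {x. psum x n = -1}
    \<le> real n * measure_pmf.prob (steps q n) {x. psum x n = -1 \<and> (\<forall>j\<in>{1..n}. x j \<le> x n)}"
proof -
  let ?E = "{x. psum x n = -1 \<and> (\<forall>j\<in>{1..n}. x j \<le> x n)}"
  have "{x. psum x n = -1} \<subseteq> (\<Union>i\<in>{1..n}. {x. rot n i x \<in> ?E})"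
  proof
    fix x :: "nat \<Rightarrow> int" assume x: "x \<in> {x. psum x n = -1}"
    have "Max (x ` {1..n}) \<in> x ` {1..n}" using n by (intro Max_in) auto
    then obtain i where i: "i \<in> {1..n}" "x i = Max (x ` {1..n})" by force
    have "x j \<le> x i" if "j \<in> {1..n}" for j using that i by simp
    then have "rot n i x j \<le> rot n i x n" if "j \<in> {1..n}" for j
      using that cyc_range[OF that, of i] i(1) by (simp only: rot_last) (simp add: rot_def)
    then have "rot n i x \<in> ?E" using x by (auto simp: psum_rot)
    then show "x \<in> (\<Union>i\<in>{1..n}. {x. rot n i x \<in> ?E})" using i(1) by blast
  qed
  then have "measure_pmf.prob (steps q n) {x. psum x n = -1} \<le> measure_pmf.prob (steps q n) (\<Union>i\<in>{1..n}. {x. rot n i x \<in> ?E})"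
    by (intro measure_pmf.finite_measure_mono) auto
  also have "\<dots> \<le> (\<Sum>i\<in>{1..n}. measure_pmf.prob (steps q n) {x. rot n i x \<in> ?E})"
    by (rule measure_UNION_le) auto
  also have "\<dots> = (\<Sum>i\<in>{1..n}. measure_pmf.prob (steps q n) ?E)"
    by (intro sum.cong refl prob_rot)
  also have "\<dots> = real n * measure_pmf.prob (steps q n) ?E" by simp
  finally show ?thesis .
qed

lemma bridge_prob_le:
  assumes n: "n \<ge> 1"
  shows "measure_pmf.prob (steps q n) {x. psum x n = -1}
    \<le> real n * measure_pmf.expectation (steps q (n - 1)) (\<lambda>f. pmf q (-1 - psum f (n - 1)) *
          indicator {f. \<forall>j\<in>{1..n-1}. f j \<le> -1 - psum f (n - 1)} f)"
proof -
  have "(\<forall>j\<in>{1..n}. (f(n := c)) j \<le> (f(n := c)) n) \<longleftrightarrow> (\<forall>j\<in>{1..n-1}. f j \<le> c)" for f :: "nat \<Rightarrow> int" and c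
  proof -
    have "{1..n} = insert n {1..n-1}" using n by auto
    then show ?thesis by auto
  qed
  then show ?thesis
    using bridge_prob_le_max_last[OF n, of q] by (simp only: prob_bridge_last_step[OF n])
qed

section \<open>The local upper bound\<close>

text \<open>Dyadic brackets with integer endpoints, so that they serve as truncation levels.\<close>

lemma dyadic_bracket:
  assumes "1 \<le> c" "c \<le> (b::nat)"
  obtains j where "j < b" "b div 2 ^ Suc j < c" "c \<le> b div 2 ^ j"
proof -
  have ex: "b div 2 ^ Suc b < c"
    using assms by (simp add: div_eq_0_iff less_le_trans[OF less_exp])
  define i where "i = (LEAST i. b div 2 ^ i < c)"
  have i: "b div 2 ^ i < c" unfolding i_def using ex by (rule LeastI)
  have "i \<noteq> 0" using i assms by (intro notI) simp
  then obtain j where j: "i = Suc j" by (cases i) auto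
  have jc: "c \<le> b div 2 ^ j" using not_less_Least[of j "\<lambda>i. b div 2 ^ i < c"] j unfolding i_def[symmetric] by simp
  then have "b div 2 ^ j \<noteq> 0" using assms by simp
  then have "2 ^ j \<le> b" by (simp add: div_eq_0_iff)
  then have "j < b" using less_exp[of j] by linarith
  then show ?thesis using that i j jc by blast
qed

context cauchy_step
begin

text \<open>Steps bounded by a constant have exponentially small probability, whereas \<open>p b\<^sub>n\<close> decays
  at most polynomially, since \<open>b\<^sub>n\<close> grows at most linearly and \<open>r\<close> decays at most like \<open>1 / b\<close>.\<close>

lemma all_small_prob:
  assumes "e > 0"
  shows "\<forall>\<^sub>F n in sequentially.
    measure_pmf.prob (steps q (n - 1)) {x. \<forall>j\<in>{1..n-1}. x j \<le> int Y} \<le> e * p (scale n)"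
proof -
  define s where "s = measure_pmf.prob q {x. x \<le> int Y}"
  obtain N where N: "N \<ge> 1" "\<And>m. m \<ge> N \<Longrightarrow> r m > 0"
    "\<And>m y. N \<le> m \<Longrightarrow> m \<le> y \<Longrightarrow> r m \<le> 2 * (real y / real m) * r y"
    using slowly_varying_seq_growth[OF slowly_varying_seq_r] by blast
  have s: "0 \<le> s" "s < 1"
  proof -
    have "p (Y + N) > 0" using N(2)[of "Y + N"] by (auto simp: r_def zero_less_mult_iff)
    then have "measure_pmf.prob q {int (Y + N)} > 0" by (simp add: p_def measure_pmf_single)
    moreover have "measure_pmf.prob q ({x. x \<le> int Y} \<union> {int (Y + N)}) = s + measure_pmf.prob q {int (Y + N)}"
      unfolding s_def using N(1) by (intro measure_pmf.finite_measure_Union) auto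
    moreover have "measure_pmf.prob q ({x. x \<le> int Y} \<union> {int (Y + N)}) \<le> 1" by simp
    ultimately show "s < 1" by linarith
  qed (simp add: s_def)
  \<comment> \<open>the cube root reduces \<open>n\<^sup>3 s\<^sup>n \<rightarrow> 0\<close> to \<open>n u\<^sup>n \<rightarrow> 0\<close>\<close>
  define u where "u = root 3 s"
  have u: "u \<ge> 0" "u < 1" "u ^ 3 = s" using s by (auto simp: u_def)
  have "(\<lambda>n. (real (n - 1) * u ^ (n - 1)) ^ 3) \<longlonglongrightarrow> 0 ^ 3"
    using powser_times_n_limit_0[of u] u
    by (intro tendsto_power filterlim_compose[OF _ filterlim_minus_const_nat_at_top[of 1], of "\<lambda>n. real n * u ^ n"]) simp
  then have lim: "(\<lambda>n. (real (n - 1) * u ^ (n - 1)) ^ 3) \<longlonglongrightarrow> 0" by simp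
  define c where "c = r N * real N / (2 * (2 * ell 0) ^ 3)"
  have c: "c > 0" using N(2)[of N] N(1) ell_pos[of 0] by (auto simp: c_def)
  have ev1: "\<forall>\<^sub>F n in sequentially. (real (n - 1) * u ^ (n - 1)) ^ 3 < e * c"
    by (rule order_tendstoD(2)[OF lim]) (use c assms in simp)
  have ev2: "\<forall>\<^sub>F n in sequentially. scale n \<ge> N" by (rule eventually_scale) blast
  show ?thesis using ev1 ev2 eventually_ge_at_top[of 2]
  proof eventually_elim
    case (elim n)
    define b where "b = scale n"
    have b: "b \<ge> N" "real b > 0" using elim N(1) by (auto simp: b_def)
    have N0: "real N > 0" using N(1) by simp
    have n: "real n \<le> 2 * real (n - 1)" "real (n - 1) > 0" using elim(3) by (auto simp: of_nat_diff)
    have "r N * real N \<le> 2 * real b * r b" using N(3)[of N b] b N0 by (simp add: field_simps)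
    then have "r N * real N / 2 \<le> real b ^ 3 * p b"
      by (simp add: r_def power2_eq_square power3_eq_cube mult_ac)
    also have "\<dots> \<le> (2 * ell 0 * real (n - 1)) ^ 3 * p b"
    proof (intro mult_right_mono power_mono)
      have "real b \<le> real n * ell 0" using scale_linear by (simp add: b_def)
      also have "\<dots> \<le> 2 * real (n - 1) * ell 0" using n ell_nonneg by (intro mult_right_mono) auto
      finally show "real b \<le> 2 * ell 0 * real (n - 1)" by (simp add: mult_ac)
    qed (auto simp: p_nonneg)
    finally have "r N * real N / 2 \<le> (2 * ell 0) ^ 3 * (real (n - 1) ^ 3 * p b)"
      by (simp add: power_mult_distrib mult_ac)
    then have cp: "c \<le> real (n - 1) ^ 3 * p b"
      using ell_pos[of 0] by (simp add: c_def field_simps)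
    have "measure_pmf.prob (steps q (n - 1)) {x. \<forall>j\<in>{1..n-1}. x j \<le> int Y} = measure_pmf.prob (steps q (n - 1)) (Pi {1..n-1} (\<lambda>_. {x. x \<le> int Y}))"
      by (rule arg_cong[of _ _ "measure_pmf.prob _"]) (auto simp: Pi_def)
    also have "\<dots> = s ^ (n - 1)"
      unfolding steps_def by (subst measure_Pi_pmf_Pi) (auto simp: s_def)
    finally have "real (n - 1) ^ 3 * measure_pmf.prob (steps q (n - 1)) {x. \<forall>j\<in>{1..n-1}. x j \<le> int Y} = (real (n - 1) * u ^ (n - 1)) ^ 3"
      using u(3) by (simp add: power_mult_distrib flip: power_mult) (simp add: mult.commute power_mult)
    also have "\<dots> \<le> e * (real (n - 1) ^ 3 * p b)"
      using elim(1) mult_left_mono[OF cp, of e] assms by linarith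
    also have "\<dots> = real (n - 1) ^ 3 * (e * p b)" by simp
    finally show ?case using n by (simp add: b_def)
  qed
qed

lemma window_ratio:
  assumes t: "0 < t" "t < 1"
  shows "\<exists>N\<ge>1. \<forall>b\<ge>N. \<forall>c. (1 - t) * real b \<le> real c \<longrightarrow> real c \<le> (1 + t) * real b \<longrightarrow>
    (1 - t) / (1 + t)\<^sup>2 * p b \<le> p c \<and> p c \<le> (1 + t) / (1 - t)\<^sup>2 * p b"
proof -
  define K where "K = 2 / (1 - t)"
  have K: "K \<ge> 1" "1 \<le> K * (1 - t)" "1 + t \<le> K" using t by (auto simp: K_def field_simps)
  obtain N where N: "\<And>m. m \<ge> N \<Longrightarrow> r m > 0"
    "\<And>m m'. m \<ge> N \<Longrightarrow> real m \<le> K * real m' \<Longrightarrow> real m' \<le> K * real m \<Longrightarrow> \<bar>r m' - r m\<bar> \<le> t * r m"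
    by (rule slowly_varying_seqE[OF slowly_varying_seq_r, of K t]) (use K t in blast)+
  show ?thesis
  proof (intro exI[of _ "max 1 N"] conjI allI impI)
    fix b c assume b: "b \<ge> max 1 N" and c: "(1 - t) * real b \<le> real c" "real c \<le> (1 + t) * real b"
    have b0: "real b > 0" "r b > 0" using b N(1) by auto
    have lo: "0 < (1 - t) * real b" using b0 t by simp
    then have c0: "real c > 0" using c by linarith
    have "1 * real b \<le> (K * (1 - t)) * real b" using K by (intro mult_right_mono) auto
    also have "\<dots> \<le> K * real c" using c K by (simp add: mult.assoc mult_left_mono)
    finally have "real b \<le> K * real c" by simp
    moreover have "real c \<le> K * real b" using c(2) mult_right_mono[OF K(3), of "real b"] by simp
    ultimately have "\<bar>r c - r b\<bar> \<le> t * r b" using N(2)[of b c] b by auto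
    then have rc: "(1 - t) * r b \<le> r c" "r c \<le> (1 + t) * r b" by (auto simp: algebra_simps abs_le_iff)
    have rc0: "r c \<ge> 0" by (simp add: r_def p_nonneg)
    have pc: "p c = r c / (real c)\<^sup>2" "p b = r b / (real b)\<^sup>2" using c0 b0 by (auto simp: p_eq)
    have "(1 - t) / (1 + t)\<^sup>2 * p b = (1 - t) * r b / ((1 + t) * real b)\<^sup>2"
      by (simp add: pc power_mult_distrib)
    also have "\<dots> \<le> r c / (real c)\<^sup>2"
      using rc rc0 c c0 b0 t by (intro frac_le power_mono) auto
    finally show "(1 - t) / (1 + t)\<^sup>2 * p b \<le> p c" by (simp add: pc)
    have "r c / (real c)\<^sup>2 \<le> (1 + t) * r b / ((1 - t) * real b)\<^sup>2"
      using rc rc0 c c0 b0 t lo by (intro frac_le power_mono) auto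
    also have "\<dots> = (1 + t) / (1 - t)\<^sup>2 * p b" by (simp add: pc power_mult_distrib)
    finally show "p c \<le> (1 + t) / (1 - t)\<^sup>2 * p b" by (simp add: pc)
  qed simp
qed

lemma dyadic_sum_le:
  assumes "0 \<le> (rho::real)" "16 * rho \<le> 1"
  shows "(\<Sum>j<J. 8 ^ j * rho ^ Suc j) \<le> 2 * rho"
proof -
  have "(\<Sum>j<J. 8 ^ j * rho ^ Suc j) = rho * (\<Sum>j<J. (8 * rho) ^ j)"
    by (simp add: sum_distrib_left power_mult_distrib mult_ac)
  also have "\<dots> \<le> rho * (\<Sum>j<J. (1/2) ^ j)"
    using assms by (intro mult_left_mono sum_mono power_mono) auto
  also have "(\<Sum>j<J. (1/2::real) ^ j) \<le> 2"
    by (simp add: sum_gp_strict) 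
  then have "rho * (\<Sum>j<J. (1/2) ^ j) \<le> rho * 2" using assms by (intro mult_left_mono) auto
  finally show ?thesis by simp
qed

text \<open>As the window shrinks, the maximum and the minimum of \<open>p\<close> over it approach each other.
  The slack \<open>e'\<close> pays for the contributions from outside the window.\<close>

lemma exists_window_width:
  fixes e :: real
  assumes "e > 0"
  shows "\<exists>t e' :: real. 0 < t \<and> t < 1 \<and> 0 < e' \<and> (1 + t) / (1 - t)\<^sup>2 + 4 * e' \<le> (1 + e) * ((1 - t) / (1 + t)\<^sup>2)"
proof -
  have "((\<lambda>t. (1 + e) * ((1 - t) / (1 + t)\<^sup>2) - (1 + t) / (1 - t)\<^sup>2) \<longlongrightarrow> (1 + e) * ((1 - 0) / (1 + 0)\<^sup>2) - (1 + 0) / (1 - 0)\<^sup>2) (at_right 0)"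
    by (intro tendsto_intros) auto
  then have "((\<lambda>t. (1 + e) * ((1 - t) / (1 + t)\<^sup>2) - (1 + t) / (1 - t)\<^sup>2) \<longlongrightarrow> e) (at_right 0)" by simp
  from order_tendstoD(1)[OF this assms]
  have "\<forall>\<^sub>F t in at_right 0. (1 + e) * ((1 - t) / (1 + t)\<^sup>2) - (1 + t) / (1 - t)\<^sup>2 > 0" .
  moreover have "\<forall>\<^sub>F t in at_right 0. (0::real) < t \<and> t < 1"
    by (auto simp: eventually_at_right_field intro!: exI[of _ 1])
  ultimately have "\<forall>\<^sub>F t in at_right 0. (1 + e) * ((1 - t) / (1 + t)\<^sup>2) - (1 + t) / (1 - t)\<^sup>2 > 0 \<and> 0 < t \<and> t < 1"
    by eventually_elim auto
  then obtain t where t: "(1 + e) * ((1 - t) / (1 + t)\<^sup>2) - (1 + t) / (1 - t)\<^sup>2 > 0" "0 < t" "t < 1"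
    using eventually_happens[of _ "at_right (0::real)"] trivial_limit_at_right_real by blast
  have "\<exists>e'. 0 < e' \<and> B + 4 * e' \<le> A" if "A - B > 0" for A B :: real
    by (rule exI[of _ "(A - B) / 4"]) (use that in \<open>simp add: field_simps\<close>)
  from this[OF t(1)] show ?thesis using t(2,3) by blast
qed

text \<open>The integrand of \<open>bridge_prob_le\<close> is split according to the value \<open>c\<close> of the closing step, which is the largest one.
  The four terms account for \<open>c \<le> Y\<close>, for \<open>c\<close> between \<open>Y\<close> and the window, bracketed dyadically, for
  \<open>c\<close> in the window, and for \<open>c\<close> above it. The factor \<open>16 * 8 ^ j\<close> comes from
  \<open>p c \<le> 2 * (b / c) ^ 3 * p b\<close> and \<open>b / c \<le> 2 ^ Suc j\<close>.\<close>

lemma jump_density_le: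
  assumes t: "0 < t" "t < 1"
  shows "\<exists>N\<ge>1. \<forall>Y\<ge>N. \<forall>\<^sub>F n in sequentially. \<forall>f. 
    pmf q (-1 - psum f (n - 1)) * indicator {f. \<forall>j\<in>{1..n-1}. f j \<le> -1 - psum f (n - 1)} f \<le>
      indicator {f. \<forall>j\<in>{1..n-1}. f j \<le> int Y} f
    + (\<Sum>j\<in>{j. j < scale n \<and> Y \<le> scale n div 2^j}. 16 * 8 ^ j * p (scale n) *
         indicator {f. (\<forall>i\<in>{1..n-1}. f i \<le> int (scale n div 2^j)) \<and> real_of_int (psum f (n-1)) \<ge> - (1 - t) * real (scale n) - 1} f)
    + (1 + t) / (1 - t)\<^sup>2 * p (scale n)
    + 2 * p (scale n) * indicator (- good_steps t n) f"
proof -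
  obtain N1 where N1: "N1 \<ge> 1" "\<And>m. m \<ge> N1 \<Longrightarrow> r m > 0"
    "\<And>m y. N1 \<le> m \<Longrightarrow> m \<le> y \<Longrightarrow> r m \<le> 2 * (real y / real m) * r y \<and> r y \<le> 2 * (real y / real m) * r m"
    using slowly_varying_seq_growth[OF slowly_varying_seq_r] by blast
  obtain N2 where N2: "\<And>b c. b \<ge> N2 \<Longrightarrow> (1 - t) * real b \<le> real c \<Longrightarrow> real c \<le> (1 + t) * real b \<Longrightarrow> p c \<le> (1 + t) / (1 - t)\<^sup>2 * p b"
    using window_ratio[OF t] by blast
  show ?thesis
  proof (intro exI[of _ N1] conjI allI impI)
    show "N1 \<ge> 1" by (rule N1(1))
    fix Y assume Y: "Y \<ge> N1"
    have "\<forall>\<^sub>F n in sequentially. scale n \<ge> N1 + N2" by (rule eventually_scale) blast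
    then show "\<forall>\<^sub>F n in sequentially. \<forall>f. 
      pmf q (-1 - psum f (n - 1)) * indicator {f. \<forall>j\<in>{1..n-1}. f j \<le> -1 - psum f (n - 1)} f \<le>
        indicator {f. \<forall>j\<in>{1..n-1}. f j \<le> int Y} f
      + (\<Sum>j\<in>{j. j < scale n \<and> Y \<le> scale n div 2^j}. 16 * 8 ^ j * p (scale n) *
           indicator {f. (\<forall>i\<in>{1..n-1}. f i \<le> int (scale n div 2^j)) \<and> real_of_int (psum f (n-1)) \<ge> - (1 - t) * real (scale n) - 1} f)
      + (1 + t) / (1 - t)\<^sup>2 * p (scale n)
      + 2 * p (scale n) * indicator (- good_steps t n) f"
    proof eventually_elim
      case (elim n)
      define b where "b = scale n"
      have b: "b \<ge> N1" "b \<ge> N2" "real b > 0" using elim N1(1) by (auto simp: b_def)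
      define A where "A j = {f. (\<forall>i\<in>{1..n-1}. f i \<le> int (b div 2^j)) \<and> real_of_int (psum f (n-1)) \<ge> - (1 - t) * real b - 1}" for j
      define I where "I = {j. j < b \<and> Y \<le> b div 2^j}"
      show ?case
      proof
        fix f :: "nat \<Rightarrow> int"
        define T1 where "T1 = (indicator {f. \<forall>j\<in>{1..n-1}. f j \<le> int Y} f :: real)"
        define T2 where "T2 = (\<Sum>j\<in>I. 16 * 8 ^ j * p b * indicator (A j) f)"
        define T3 where "T3 = (1 + t) / (1 - t)\<^sup>2 * p b"
        define T4 where "T4 = 2 * p b * indicator (- good_steps t n) f"
        have nn: "0 \<le> T1" "0 \<le> T2" "0 \<le> T3" "0 \<le> T4"
          using t by (auto simp: T1_def T2_def T3_def T4_def p_nonneg intro!: sum_nonneg)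
        define c where "c = -1 - psum f (n - 1)"
        have "pmf q c * indicator {f. \<forall>j\<in>{1..n-1}. f j \<le> -1 - psum f (n - 1)} f \<le> T1 + T2 + T3 + T4"
        proof (cases "\<forall>j\<in>{1..n-1}. f j \<le> c")
          case True
          then have "indicator {f. \<forall>j\<in>{1..n-1}. f j \<le> -1 - psum f (n - 1)} f = (1::real)"
            by (simp add: c_def)
          moreover have "pmf q c \<le> T1 + T2 + T3 + T4"
          proof (cases "c \<le> int Y")
            case True
            have "f j \<le> int Y" if "j \<in> {1..n-1}" for j
              using order_trans[OF bspec[OF \<open>\<forall>j\<in>{1..n-1}. f j \<le> c\<close> that] True] .
            then have "T1 = 1" by (simp add: T1_def)
            then show ?thesis using nn pmf_le_1[of q c] by linarith
          next
            case False
            define m where "m = nat c"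
            have m: "c = int m" "m \<ge> N1" "m > Y" "m \<ge> 1" using False Y N1(1) by (auto simp: m_def)
            have pm: "pmf q c = p m" by (simp add: m p_def)
            have m0: "real m > 0" using m by simp
            have pmr: "p m = r m / (real m)\<^sup>2" and pbr: "p b = r b / (real b)\<^sup>2"
              using m b by (auto intro!: p_eq)
            have "real m \<le> (1 - t) * real b \<or> ((1 - t) * real b \<le> real m \<and> real m \<le> (1 + t) * real b) \<or> (1 + t) * real b < real m"
              by linarith
            then consider "real m \<le> (1 - t) * real b" | "(1 - t) * real b \<le> real m" "real m \<le> (1 + t) * real b" | "(1 + t) * real b < real m"
              by blast
            then show ?thesis
            proof cases
              case 1
              have "(1 - t) * real b \<le> 1 * real b" using t by (intro mult_right_mono) auto
              then have mb: "m \<le> b" using 1 by simp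
              obtain j where j: "j < b" "b div 2 ^ Suc j < m" "m \<le> b div 2 ^ j"
                using dyadic_bracket[OF m(4) mb] by blast
              have "b < m * 2 ^ Suc j" using j(2) by (simp add: div_less_iff_less_mult)
              then have "real b \<le> real (m * 2 ^ Suc j)" by (simp only: of_nat_le_iff)
              then have "real b \<le> real m * 2 ^ Suc j" by simp
              then have q: "real b / real m \<le> 2 ^ Suc j" using m0 by (simp add: field_simps)
              have "p m \<le> 2 * (real b / real m) * r b / (real m)\<^sup>2"
                unfolding pmr using N1(3)[of m b] m mb by (intro divide_right_mono) auto
              also have "\<dots> = 2 * (real b / real m) ^ 3 * p b"
                using b by (simp add: pbr power2_eq_square power3_eq_cube)
              also have "\<dots> \<le> 2 * (2 ^ Suc j) ^ 3 * p b"
                using q p_nonneg by (intro mult_right_mono mult_left_mono power_mono) auto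
              also have "2 * (2 ^ Suc j) ^ 3 = (16 * 8 ^ j :: real)"
                by (simp add: power_mult_distrib power3_eq_cube flip: power_mult_distrib)
              finally have pm2: "p m \<le> 16 * 8 ^ j * p b" .
              have jI: "j \<in> I" using j m by (auto simp: I_def)
              have "f \<in> A j"
                using \<open>\<forall>j\<in>{1..n-1}. f j \<le> c\<close> j 1 m unfolding A_def c_def
                by (auto simp: algebra_simps intro: order_trans)
              then have "16 * 8 ^ j * p b = 16 * 8 ^ j * p b * indicator (A j) f" by simp
              also have "\<dots> \<le> T2" unfolding T2_def
                by (rule member_le_sum[OF jI]) (auto simp: I_def p_nonneg)
              finally show ?thesis using pm2 pm nn by linarith
            next
              case 2
              then have "p m \<le> T3" unfolding T3_def using N2 b by blast
              then show ?thesis using pm nn by linarith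
            next
              case 3
              have "real b \<le> (1 + t) * real b" using t mult_right_mono[of 1 "1 + t" "real b"] by simp
              then have bm: "b \<le> m" using 3 by simp
              have "p m \<le> 2 * (real m / real b) * r b / (real m)\<^sup>2"
                unfolding pmr using N1(3)[of b m] b bm by (intro divide_right_mono) auto
              also have "\<dots> = 2 * (real b / real m) * p b"
                using b m0 by (simp add: pbr power2_eq_square)
              also have "\<dots> \<le> 2 * 1 * p b"
                using bm m0 p_nonneg by (intro mult_right_mono mult_left_mono) auto
              finally have "p m \<le> 2 * p b" by simp
              moreover have "f \<notin> good_steps t n"
                using 3 m unfolding good_steps_def c_def b_def by auto
              then have "T4 = 2 * p b" by (simp add: T4_def)
              ultimately show ?thesis using pm nn by linarith
            qed
          qed
          ultimately show ?thesis by simp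
        next
          case False
          then have "indicator {f. \<forall>j\<in>{1..n-1}. f j \<le> -1 - psum f (n - 1)} f = (0::real)"
            by (simp add: c_def indicator_def)
          then show ?thesis using nn by simp
        qed
        then show "pmf q (-1 - psum f (n - 1)) * indicator {f. \<forall>j\<in>{1..n-1}. f j \<le> -1 - psum f (n - 1)} f \<le>
            indicator {f. \<forall>j\<in>{1..n-1}. f j \<le> int Y} f
          + (\<Sum>j\<in>{j. j < scale n \<and> Y \<le> scale n div 2^j}. 16 * 8 ^ j * p (scale n) *
               indicator {f. (\<forall>i\<in>{1..n-1}. f i \<le> int (scale n div 2^j)) \<and> real_of_int (psum f (n-1)) \<ge> - (1 - t) * real (scale n) - 1} f)
          + (1 + t) / (1 - t)\<^sup>2 * p (scale n)
          + 2 * p (scale n) * indicator (- good_steps t n) f"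
          unfolding T1_def T2_def T3_def T4_def A_def I_def b_def c_def .
      qed
    qed
  qed
qed

text \<open>Integrating the pointwise bound: on the \<open>j\<close>-th dyadic level \<open>upper_deviation\<close> gives the
  factor \<open>rho ^ Suc j\<close>, where \<open>rho\<close> is small once the tilt \<open>k\<close> is large, so that the levels sum up to
  a small multiple of \<open>p b\<^sub>n\<close>.\<close>

lemma bridge_local_upper_bound:
  assumes t: "0 < t" "t < 1" and e: "e > 0"
  shows "\<forall>\<^sub>F n in sequentially. measure_pmf.prob (steps q n) {x. psum x n = -1}
     \<le> real n * (((1 + t) / (1 - t)\<^sup>2 + 4 * e) * p (scale n))"
proof -
  \<comment> \<open>a tilt for which \<open>16 * rho \<le> 1\<close>, as the dyadic sum requires, and \<open>32 * rho \<le> e\<close>\<close>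
  define k where "k = 2 / t * (\<bar>ln (min (1/16) (e / 32))\<bar> + 1)"
  define rho where "rho = exp (- (k * t / 2))"
  have k: "k > 0" using t by (simp add: k_def add_nonneg_pos)
  have rho: "0 < rho" "rho \<le> 1/16" "rho \<le> e / 32"
  proof -
    have m: "min (1/16) (e / 32) > 0" using e by simp
    have "k * t / 2 = \<bar>ln (min (1/16) (e / 32))\<bar> + 1" using t by (simp add: k_def)
    then have "- (k * t / 2) \<le> ln (min (1/16) (e / 32))" by linarith
    then have "rho \<le> exp (ln (min (1/16) (e / 32)))" unfolding rho_def by simp
    then have "rho \<le> min (1/16) (e/32)" using m by simp
    then show "rho \<le> 1/16" "rho \<le> e / 32" by auto
  qed (simp add: rho_def)
  obtain Y1 where Y1: "Y1 \<ge> 1" "\<forall>\<^sub>F n in sequentially. \<forall>y. Y1 \<le> y \<longrightarrow> y \<le> scale n \<longrightarrow>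
    measure_pmf.prob (steps q (n - 1))
      {x. (\<forall>j\<in>{1..n-1}. x j \<le> int y) \<and> real_of_int (psum x (n-1)) \<ge> - (1 - t) * real (scale n) - 1}
    \<le> exp (- (k * t / 2) * (real (scale n) / real y))"
    using upper_deviation[OF t k] by blast
  obtain N where N: "\<And>Y. Y \<ge> N \<Longrightarrow> \<forall>\<^sub>F n in sequentially. \<forall>f. 
    pmf q (-1 - psum f (n - 1)) * indicator {f. \<forall>j\<in>{1..n-1}. f j \<le> -1 - psum f (n - 1)} f \<le>
      indicator {f. \<forall>j\<in>{1..n-1}. f j \<le> int Y} f
    + (\<Sum>j\<in>{j. j < scale n \<and> Y \<le> scale n div 2^j}. 16 * 8 ^ j * p (scale n) *
         indicator {f. (\<forall>i\<in>{1..n-1}. f i \<le> int (scale n div 2^j)) \<and> real_of_int (psum f (n-1)) \<ge> - (1 - t) * real (scale n) - 1} f)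
    + (1 + t) / (1 - t)\<^sup>2 * p (scale n)
    + 2 * p (scale n) * indicator (- good_steps t n) f"
    using jump_density_le[OF t] by blast
  define Y where "Y = max N Y1"
  have YN: "Y \<ge> N" "Y \<ge> Y1" "Y \<ge> 1" using Y1(1) by (auto simp: Y_def)
  show ?thesis
    using N[OF YN(1)] Y1(2) all_small_prob[OF e, of Y] good_steps_likely[OF t e] eventually_ge_at_top[of 1]
  proof eventually_elim
    case (elim n)
    define b where "b = scale n"
    define A where "A j = {f. (\<forall>i\<in>{1..n-1}. f i \<le> int (b div 2^j)) \<and> real_of_int (psum f (n-1)) \<ge> - (1 - t) * real b - 1}" for j
    define I where "I = {j. j < b \<and> Y \<le> b div 2^j}"
    define S where "S = {f :: nat \<Rightarrow> int. \<forall>j\<in>{1..n-1}. f j \<le> int Y}"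
    let ?Q = "steps q (n - 1)"
    let ?P = "measure_pmf.prob ?Q"
    let ?g = "\<lambda>f. pmf q (-1 - psum f (n - 1)) * indicator {f. \<forall>j\<in>{1..n-1}. f j \<le> -1 - psum f (n - 1)} f :: real"
    let ?h = "\<lambda>f. indicator S f + (\<Sum>j\<in>I. 16 * 8 ^ j * p b * indicator (A j) f) + (1 + t) / (1 - t)\<^sup>2 * p b
        + 2 * p b * indicator (- good_steps t n) f :: real"
    have gh: "?g f \<le> ?h f" for f
      using elim(1)[THEN spec, of f] unfolding A_def I_def S_def b_def .
    have fI: "finite I" by (rule finite_subset[of _ "{..<b}"]) (auto simp: I_def)
    have ig: "integrable (measure_pmf ?Q) ?g"
      by (rule measure_pmf.integrable_const_bound[where B = 1]) (auto simp: indicator_def pmf_le_1)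
    have "measure_pmf.expectation ?Q ?g \<le> measure_pmf.expectation ?Q ?h"
      by (intro integral_mono ig gh Bochner_Integration.integrable_add Bochner_Integration.integrable_sum
          integrable_mult_right integrable_indicator_pmf) auto
    also have "\<dots> = ?P S + (\<Sum>j\<in>I. 16 * 8 ^ j * p b * ?P (A j)) + (1 + t) / (1 - t)\<^sup>2 * p b + 2 * p b * ?P (- good_steps t n)"
      by (simp add: Bochner_Integration.integral_add Bochner_Integration.integral_sum integrable_indicator_pmf)
    also have "?P S \<le> e * p b" using elim(3) by (simp add: S_def b_def)
    also have "(\<Sum>j\<in>I. 16 * 8 ^ j * p b * ?P (A j)) \<le> (\<Sum>j\<in>I. 16 * p b * (8 ^ j * rho ^ Suc j))"
    proof (rule sum_mono)
      fix j assume j: "j \<in> I"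
      define y where "y = b div 2 ^ j"
      have y: "Y1 \<le> y" "y \<le> b" "real y > 0" using j YN by (auto simp: I_def y_def)
      have "?P (A j) \<le> exp (- (k * t / 2) * (real b / real y))"
        using elim(2) y unfolding A_def b_def y_def by blast
      also have "\<dots> \<le> exp (- (k * t / 2) * real (Suc j))"
      proof -
        have "y * 2 ^ j \<le> b" by (simp add: y_def)
        then have "real (y * 2 ^ j) \<le> real b" by (simp only: of_nat_le_iff)
        then have "real y * 2 ^ j \<le> real b" by simp
        then have "2 ^ j \<le> real b / real y" using y by (simp add: field_simps)
        moreover have "Suc j \<le> 2 ^ j" by (simp add: Suc_leI less_exp)
        then have "real (Suc j) \<le> real (2 ^ j)" by (simp only: of_nat_le_iff)
        then have "real (Suc j) \<le> 2 ^ j" by simp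
        ultimately have "real (Suc j) \<le> real b / real y" by linarith
        then show ?thesis using k t by (simp only: exp_le_cancel_iff) (intro mult_left_mono_neg, auto)
      qed
      also have "\<dots> = rho ^ Suc j" unfolding rho_def by (subst exp_of_nat_mult[symmetric]) (simp add: mult.commute)
      finally have "?P (A j) \<le> rho ^ Suc j" .
      then have "16 * 8 ^ j * p b * ?P (A j) \<le> 16 * 8 ^ j * p b * rho ^ Suc j"
        using p_nonneg by (intro mult_left_mono) auto
      then show "16 * 8 ^ j * p b * ?P (A j) \<le> 16 * p b * (8 ^ j * rho ^ Suc j)" by (simp only: mult_ac)
    qed
    also have "(\<Sum>j\<in>I. 16 * p b * (8 ^ j * rho ^ Suc j)) \<le> (\<Sum>j<b. 16 * p b * (8 ^ j * rho ^ Suc j))"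
      using rho p_nonneg by (intro sum_mono2) (auto simp: I_def)
    also have "\<dots> = 16 * p b * (\<Sum>j<b. 8 ^ j * rho ^ Suc j)" by (simp only: sum_distrib_left)
    also have "\<dots> \<le> 16 * p b * (2 * rho)"
      using rho p_nonneg by (intro mult_left_mono dyadic_sum_le) auto
    also have "\<dots> \<le> 16 * p b * (2 * (e / 32))"
      using rho p_nonneg by (intro mult_left_mono) auto
    also have "2 * p b * ?P (- good_steps t n) \<le> 2 * p b * e"
    proof (intro mult_left_mono)
      show "?P (- good_steps t n) \<le> e"
        using elim(4) measure_pmf.prob_compl[of "good_steps t n" ?Q] by (simp add: Compl_eq_Diff_UNIV)
    qed (simp add: p_nonneg)
    finally have "measure_pmf.expectation ?Q ?g \<le> e * p b + 16 * p b * (2 * (e / 32)) + (1 + t) / (1 - t)\<^sup>2 * p b + 2 * p b * e"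
      by simp
    also have "\<dots> = ((1 + t) / (1 - t)\<^sup>2 + 4 * e) * p b" by (simp add: algebra_simps)
    finally have "real n * measure_pmf.expectation ?Q ?g \<le> real n * (((1 + t) / (1 - t)\<^sup>2 + 4 * e) * p b)"
      by (intro mult_left_mono) auto
    then show ?case
      using bridge_prob_le[OF elim(5), of q] by (simp add: b_def)
  qed
qed

text \<open>The one big jump principle in the form needed for total variation: typically the closing step
  has density at least \<open>pm n\<close> and exceeds all others, and \<open>n * pm n\<close> is, up to the factor
  \<open>1 + e\<close>, an upper bound for the probability of a bridge.\<close>

theorem one_big_jump:
  assumes e: "e > 0"
  shows "\<exists>G pm. \<forall>\<^sub>F n in sequentially. pm n > 0 \<and>
     measure_pmf.prob (steps q (n - 1)) (G n) \<ge> 1 - e \<and>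
     measure_pmf.prob (steps q n) {x. psum x n = -1} \<le> (1 + e) * (real n * pm n) \<and>
     (\<forall>f\<in>G n. pm n \<le> pmf q (-1 - psum f (n - 1)) \<and> (\<forall>j\<in>{1..n-1}. f j < -1 - psum f (n - 1)))"
proof -
  obtain t e' where t: "0 < t" "t < 1" "0 < e'"
    and te: "(1 + t) / (1 - t)\<^sup>2 + 4 * e' \<le> (1 + e) * ((1 - t) / (1 + t)\<^sup>2)"
    using exists_window_width[OF e] by blast
  obtain N where N: "N \<ge> 1" "\<And>b c. b \<ge> N \<Longrightarrow> (1 - t) * real b \<le> real c \<Longrightarrow> real c \<le> (1 + t) * real b \<Longrightarrow>
      (1 - t) / (1 + t)\<^sup>2 * p b \<le> p c"
    using window_ratio[OF t(1,2)] by blast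
  obtain N' where N': "\<And>m. m \<ge> N' \<Longrightarrow> r m > 0" using r_eventually_pos by blast
  define pm where "pm n = (1 - t) / (1 + t)\<^sup>2 * p (scale n)" for n
  have ev: "\<forall>\<^sub>F n in sequentially. scale n \<ge> N + N'" by (rule eventually_scale) blast
  have "\<forall>\<^sub>F n in sequentially. pm n > 0 \<and>
     measure_pmf.prob (steps q (n - 1)) (good_steps t n) \<ge> 1 - e \<and>
     measure_pmf.prob (steps q n) {x. psum x n = -1} \<le> (1 + e) * (real n * pm n) \<and>
     (\<forall>f\<in>good_steps t n. pm n \<le> pmf q (-1 - psum f (n - 1)) \<and> (\<forall>j\<in>{1..n-1}. f j < -1 - psum f (n - 1)))"
    using ev bridge_local_upper_bound[OF t(1,2,3)] good_steps_likely[OF t(1,2) e]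
  proof eventually_elim
    case (elim n)
    define b where "b = scale n"
    have b: "b \<ge> N" "b \<ge> N'" using elim(1) by (auto simp: b_def)
    have pb: "p b > 0" using N'[OF b(2)] by (auto simp: r_def zero_less_mult_iff)
    have bound: "real n * (((1 + t) / (1 - t)\<^sup>2 + 4 * e') * p b) \<le> (1 + e) * (real n * pm n)"
    proof -
      have "real n * (((1 + t) / (1 - t)\<^sup>2 + 4 * e') * p b) \<le> real n * (((1 + e) * ((1 - t) / (1 + t)\<^sup>2)) * p b)"
        using te pb by (intro mult_left_mono mult_right_mono) auto
      also have "\<dots> = (1 + e) * (real n * pm n)" by (simp only: pm_def b_def mult_ac)
      finally show ?thesis .
    qed
    have G: "pm n \<le> pmf q (-1 - psum f (n - 1)) \<and> (\<forall>j\<in>{1..n-1}. f j < -1 - psum f (n - 1))"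
      if f: "f \<in> good_steps t n" for f
    proof -
      define m where "m = nat (-1 - psum f (n - 1))"
      have lo: "(1 - t) * real b < real_of_int (-1 - psum f (n - 1))"
        and hi: "real_of_int (-1 - psum f (n - 1)) \<le> (1 + t) * real b"
        and others: "\<And>j. j \<in> {1..n-1} \<Longrightarrow> real_of_int (f j) \<le> (1 - t) * real b"
        using f unfolding good_steps_def b_def by blast+
      have "0 \<le> (1 - t) * real b" using t by simp
      then have "real_of_int (-1 - psum f (n - 1)) > 0" using lo by linarith
      then have m: "-1 - psum f (n - 1) = int m" by (simp add: m_def)
      have "pm n \<le> p m" using N(2)[OF b(1), of m] lo hi unfolding m by (simp add: pm_def b_def)
      moreover have "f j < -1 - psum f (n - 1)" if "j \<in> {1..n-1}" for j
        using others[OF that] lo by linarith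
      ultimately show ?thesis unfolding p_def m[symmetric] by blast
    qed
    have "pm n > 0" using pb t by (simp add: pm_def b_def)
    moreover have "measure_pmf.prob (steps q n) {x. psum x n = -1} \<le> (1 + e) * (real n * pm n)"
      using order_trans[OF elim(2)[folded b_def] bound] .
    ultimately show ?case using elim(3) G by blast
  qed
  then show ?thesis by (intro exI)
qed

end

section \<open>First passage and the Vervaat transform\<close>

definition first_pass :: "nat \<Rightarrow> (nat \<Rightarrow> int) set" where
  "first_pass n = {x. psum x n = -1 \<and> (\<forall>i<n. psum x i \<ge> 0)}"

text \<open>The rotated path first follows the original one after time \<open>k\<close>, then its beginning, lifted by
  the final value.\<close>

lemma psum_rot_eq:
  assumes "k \<le> n" "i \<le> n"
  shows "psum (rot n k x) i =
    (if k + i \<le> n then psum x (k + i) - psum x k else psum x n - psum x k + psum x (k + i - n))"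
  using assms(2)
proof (induction i)
  case 0
  then show ?case using assms(1) by simp
next
  case (Suc i)
  have step: "rot n k x (Suc i) = x ((k + i) mod n + 1)" using Suc.prems by (simp add: rot_def cyc_def)
  show ?case
  proof (cases "k + i < n")
    case True
    then show ?thesis using Suc step by simp
  next
    case False
    have "(k + i) mod n = k + i - n"
      using False Suc.prems assms(1) by (subst le_mod_geq) auto
    moreover have "k + Suc i - n = Suc (k + i - n)" using False by simp
    moreover have "psum x (k + i - n) = 0 \<and> psum x (k + i) = psum x n" if "k + i = n" using that by simp
    ultimately show ?thesis using Suc step False by (cases "k + i = n") auto
  qed
qed

lemma first_argmin_eq_iff:
  "first_argmin n w = k \<longleftrightarrow> k \<le> n \<and> (\<forall>j\<le>n. w k \<le> w j) \<and> (\<forall>j<k. w k < w j)"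
proof -
  let ?P = "\<lambda>i. i \<le> n \<and> w i = Min (w ` {0..n})"
  have P: "?P i \<longleftrightarrow> i \<le> n \<and> (\<forall>j\<le>n. w i \<le> w j)" for i
    by (auto intro!: Min_le Min_eqI[symmetric])
  have "Min (w ` {0..n}) \<in> w ` {0..n}" by (intro Min_in) auto
  then obtain i where "?P i" by force
  then have L: "?P (first_argmin n w)" unfolding first_argmin_def by (rule LeastI)
  have less: "\<not> ?P j" if "j < first_argmin n w" for j
    using that not_less_Least unfolding first_argmin_def by blast
  show ?thesis
  proof
    assume k: "first_argmin n w = k"
    have 1: "k \<le> n" "\<forall>j\<le>n. w k \<le> w j" using L P k by auto
    moreover have "w k < w j" if "j < k" for j
    proof (rule ccontr)
      assume "\<not> w k < w j"
      then have "\<forall>j'\<le>n. w j \<le> w j'" using 1(2) by (meson not_less order_trans)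
      then show False using less[of j] P[of j] that k 1 by auto
    qed
    ultimately show "k \<le> n \<and> (\<forall>j\<le>n. w k \<le> w j) \<and> (\<forall>j<k. w k < w j)" by blast
  next
    assume k: "k \<le> n \<and> (\<forall>j\<le>n. w k \<le> w j) \<and> (\<forall>j<k. w k < w j)"
    have "\<not> first_argmin n w < k" using L P k by (meson not_less)
    moreover have "\<not> k < first_argmin n w" using less[of k] P[of k] k by blast
    ultimately show "first_argmin n w = k" by simp
  qed
qed

lemma first_argmin_cong:
  assumes "\<And>i. i \<le> n \<Longrightarrow> w i = w' i"
  shows "first_argmin n w = first_argmin n w'"
  using assms first_argmin_eq_iff[of n w' "first_argmin n w'"]
  by (subst first_argmin_eq_iff) (auto simp: less_imp_le)

lemma first_argmin_bridge:
  assumes "psum x n = -1"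
  shows "first_argmin n (psum x) \<in> {1..n}"
proof -
  have "first_argmin n (psum x) \<le> n" "psum x (first_argmin n (psum x)) \<le> psum x n"
    using first_argmin_eq_iff[of n "psum x" "first_argmin n (psum x)"] by auto
  then show ?thesis using assms by (cases "first_argmin n (psum x)") auto
qed

text \<open>The cycle lemma: among the \<open>n\<close> rotations of a bridge from \<open>0\<close> to \<open>-1\<close> exactly one stays
  non-negative before time \<open>n\<close>, namely the one that starts at the first minimum. The part after
  time \<open>k\<close> must not go below the level at \<open>k\<close>, and the part before, lowered by 1, must stay
  strictly above it.\<close>

lemma rot_first_pass_iff:
  assumes x: "psum x n = -1" and k: "k \<in> {1..n}"
  shows "rot n k x \<in> first_pass n \<longleftrightarrow> first_argmin n (psum x) = k"
proof -
  have kn: "k \<le> n" "1 \<le> k" using k by auto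
  have "rot n k x \<in> first_pass n \<longleftrightarrow> (\<forall>i<n. psum (rot n k x) i \<ge> 0)"
    by (simp add: first_pass_def psum_rot x)
  also have "\<dots> \<longleftrightarrow> (\<forall>j\<le>n. psum x k \<le> psum x j) \<and> (\<forall>j<k. psum x k < psum x j)"
  proof
    assume A: "\<forall>i<n. psum (rot n k x) i \<ge> 0"
    have le: "psum x k \<le> psum x j" if "k \<le> j" "j \<le> n" for j
      using A[rule_format, of "j - k"] that kn by (simp add: psum_rot_eq split: if_splits)
    have lt: "psum x k < psum x j" if "j < k" for j
    proof -
      have "n + j - k < n" using that kn by arith
      then show ?thesis
        using A[rule_format, of "n + j - k"] le[of n] that kn x
        by (cases "j = 0") (auto simp: psum_rot_eq split: if_splits)
    qed
    show "(\<forall>j\<le>n. psum x k \<le> psum x j) \<and> (\<forall>j<k. psum x k < psum x j)"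
      using le lt by (meson not_le less_imp_le)
  next
    assume A: "(\<forall>j\<le>n. psum x k \<le> psum x j) \<and> (\<forall>j<k. psum x k < psum x j)"
    show "\<forall>i<n. psum (rot n k x) i \<ge> 0"
    proof (intro allI impI)
      fix i assume i: "i < n"
      show "psum (rot n k x) i \<ge> 0"
      proof (cases "k + i \<le> n")
        case True
        then show ?thesis using A kn i by (simp add: psum_rot_eq)
      next
        case False
        then have "k + i - n < k" using i by simp
        then have "psum x k < psum x (k + i - n)" using A by blast
        then show ?thesis using False kn i x by (simp add: psum_rot_eq)
      qed
    qed
  qed
  also have "\<dots> \<longleftrightarrow> first_argmin n (psum x) = k" using kn by (simp add: first_argmin_eq_iff)
  finally show ?thesis .
qed

lemma vervaat_cong:
  assumes "\<And>i. i \<le> n \<Longrightarrow> w i = w' i" "i \<le> n"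
  shows "vervaat n w i = vervaat n w' i"
  using assms(2)
proof (induction i)
  case (Suc i)
  let ?m = "(first_argmin n w + i) mod n"
  have "?m < n" using Suc.prems by simp
  then have "increment w (?m + 1) = increment w' (?m + 1)"
    using assms(1) by (simp add: increment_def)
  moreover have "first_argmin n w = first_argmin n w'" using assms(1) by (rule first_argmin_cong)
  ultimately show ?case using Suc by simp
qed simp

lemma vervaat_eq_rot:
  assumes "i \<le> n"
  shows "vervaat n (psum x) i = psum (rot n (first_argmin n (psum x)) x) i"
  using assms by (induction i) (auto simp: increment_def rot_def cyc_def)

lemma cyc_Suc: "i < n \<Longrightarrow> cyc n k (Suc i) = (k + i) mod n + 1"
  by (simp add: cyc_def)

lemma cyc_outside: "j \<notin> {1..n} \<Longrightarrow> cyc n k j = j"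
  by (simp only: cyc_def if_False)

lemma cyc_cyc: "cyc n a (cyc n b j) = cyc n (a + b) j"
proof (cases "j \<in> {1..n}")
  case True
  then obtain i where i: "j = Suc i" "i < n" by (cases j) auto
  then have "(b + i) mod n < n" by simp
  then have "cyc n a (cyc n b j) = (a + (b + i) mod n) mod n + 1"
    using i by (simp add: cyc_Suc)
  then show ?thesis using i by (simp add: cyc_Suc mod_simps add.assoc)
qed (simp only: cyc_outside not_False_eq_True)

lemma cyc_mod: "cyc n (k mod n) j = cyc n k j"
proof (cases "j \<in> {1..n}")
  case True
  then obtain i where i: "j = Suc i" "i < n" by (cases j) auto
  then show ?thesis by (simp add: cyc_Suc mod_simps)
qed (simp only: cyc_outside not_False_eq_True)

lemma rot_rot: "rot n a (rot n b x) = rot n (b + a) x"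
  by (auto simp: rot_def cyc_cyc fun_eq_iff)

lemma rot_mod: "rot n (k mod n) = rot n k"
  by (simp add: rot_def cyc_mod fun_eq_iff)

text \<open>All rotations of a bridge have the same first passage rotation.\<close>

lemma vervaat_rot:
  assumes x: "psum x n = -1" and i: "i \<le> n"
  shows "vervaat n (psum (rot n j x)) i = vervaat n (psum x) i"
proof -
  define k where "k = first_argmin n (psum x)"
  have k: "k \<in> {1..n}" unfolding k_def by (rule first_argmin_bridge[OF x])
  have n0: "n > 0" using k by simp
  \<comment> \<open>rotating by \<open>j\<close> and then by \<open>k - j\<close> modulo \<open>n\<close>, represented in \<open>{1..n}\<close>, is rotating by \<open>k\<close>\<close>
  define k0 where "k0 = (k + (n - j mod n)) mod n"
  define k' where "k' = (if k0 = 0 then n else k0)"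
  have k': "k' \<in> {1..n}" "k' mod n = k0 mod n" using n0 by (auto simp: k'_def k0_def less_imp_le Suc_le_eq)
  have "(j + k') mod n = (j mod n + k' mod n) mod n" by (simp add: mod_simps)
  also have "\<dots> = (j mod n + (k + (n - j mod n))) mod n" unfolding k'(2) by (simp add: k0_def mod_simps)
  also have "j mod n + (k + (n - j mod n)) = k + n"
    using mod_less_divisor[OF n0, of j] by linarith
  finally have "(j + k') mod n = k mod n" by simp
  then have eq: "rot n k' (rot n j x) = rot n k x"
    unfolding rot_rot using rot_mod[of n "j + k'"] rot_mod[of n k] by simp
  have "rot n k x \<in> first_pass n" using rot_first_pass_iff[OF x k] by (simp add: k_def)
  then have "first_argmin n (psum (rot n j x)) = k'"
    using rot_first_pass_iff[of "rot n j x" n k'] eq k' x by (simp add: psum_rot)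
  then show ?thesis using eq i by (simp add: vervaat_eq_rot k_def)
qed

text \<open>Events of paths \<open>(w\<^sub>0, \<dots>, w\<^sub>n)\<close>, as predicates on functions that only look at the times up
  to \<open>n\<close>.\<close>

definition path_event :: "nat \<Rightarrow> ((nat \<Rightarrow> int) \<Rightarrow> bool) \<Rightarrow> bool" where
  "path_event n H \<longleftrightarrow> (\<forall>w w'. (\<forall>i\<le>n. w i = w' i) \<longrightarrow> H w = H w')"

lemma path_eventD: "path_event n H \<Longrightarrow> (\<And>i. i \<le> n \<Longrightarrow> w i = w' i) \<Longrightarrow> H w = H w'"
  unfolding path_event_def by blast

text \<open>The set of bridges splits according to the time \<open>k\<close> of the first minimum. Rotation by \<open>k\<close>
  maps the \<open>k\<close>-th part onto the first passage paths and preserves the law.\<close>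

lemma bridge_vervaat_prob:
  assumes H: "path_event n H"
  shows "measure_pmf.prob (steps q n) {x. psum x n = -1 \<and> H (vervaat n (psum x))}
    = real n * measure_pmf.prob (steps q n) {x \<in> first_pass n. H (psum x)}"
proof -
  let ?F = "{x \<in> first_pass n. H (psum x)}"
  have "{x. psum x n = -1 \<and> H (vervaat n (psum x))} = (\<Union>k\<in>{1..n}. {x. rot n k x \<in> ?F})"
  proof (intro equalityI subsetI)
    fix x assume "x \<in> {x. psum x n = -1 \<and> H (vervaat n (psum x))}"
    then have x: "psum x n = -1" "H (vervaat n (psum x))" by auto
    define k where "k = first_argmin n (psum x)"
    have k: "k \<in> {1..n}" unfolding k_def by (rule first_argmin_bridge[OF x(1)])
    have "H (psum (rot n k x)) = H (vervaat n (psum x))"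
      by (rule path_eventD[OF H]) (simp add: vervaat_eq_rot k_def)
    then have "rot n k x \<in> ?F" using rot_first_pass_iff[OF x(1) k] x(2) by (simp add: k_def)
    then show "x \<in> (\<Union>k\<in>{1..n}. {x. rot n k x \<in> ?F})" using k by blast
  next
    fix x assume "x \<in> (\<Union>k\<in>{1..n}. {x. rot n k x \<in> ?F})"
    then obtain k where k: "k \<in> {1..n}" "rot n k x \<in> first_pass n" "H (psum (rot n k x))" by auto
    have x: "psum x n = -1" using k(2) by (simp add: first_pass_def psum_rot)
    have "first_argmin n (psum x) = k" using rot_first_pass_iff[OF x k(1)] k(2) by simp
    then have "H (psum (rot n k x)) = H (vervaat n (psum x))"
      by (intro path_eventD[OF H]) (simp add: vervaat_eq_rot)
    then show "x \<in> {x. psum x n = -1 \<and> H (vervaat n (psum x))}" using x k(3) by simp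
  qed
  moreover have "disjoint_family_on (\<lambda>k. {x. rot n k x \<in> ?F}) {1..n}"
  proof (unfold disjoint_family_on_def, intro ballI impI)
    fix k l assume kl: "k \<in> {1..n}" "l \<in> {1..n}" "k \<noteq> l"
    have "k = l" if "rot n k x \<in> ?F" "rot n l x \<in> ?F" for x
    proof -
      have "psum x n = -1" using that by (simp add: first_pass_def psum_rot)
      then show ?thesis using rot_first_pass_iff kl that by blast
    qed
    then show "{x. rot n k x \<in> ?F} \<inter> {x. rot n l x \<in> ?F} = {}" using kl(3) by blast
  qed
  ultimately have "measure_pmf.prob (steps q n) {x. psum x n = -1 \<and> H (vervaat n (psum x))}
     = (\<Sum>k\<in>{1..n}. measure_pmf.prob (steps q n) {x. rot n k x \<in> ?F})"
    by (simp only:) (rule measure_pmf.finite_measure_finite_Union, auto)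
  also have "\<dots> = (\<Sum>k\<in>{1..n}. measure_pmf.prob (steps q n) ?F)"
    by (intro sum.cong refl prob_rot)
  finally show ?thesis by simp
qed

text \<open>The \<open>n\<close> rotations of the event that the last step is the strict maximum are disjoint and
  equally likely, and the Vervaat transform takes the same value on all rotations of a path.\<close>

lemma strict_max_last_prob:
  assumes n: "n \<ge> 1" and H: "path_event n H"
  shows "real n * measure_pmf.prob (steps q n)
      {x. psum x n = -1 \<and> H (vervaat n (psum x)) \<and> (\<forall>j\<in>{1..n-1}. x j < x n)}
    \<le> measure_pmf.prob (steps q n) {x. psum x n = -1 \<and> H (vervaat n (psum x))}"
proof -
  let ?E = "{x. psum x n = -1 \<and> H (vervaat n (psum x)) \<and> (\<forall>j\<in>{1..n-1}. x j < x n)}"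
  have less: "x i' < x i" if "i \<in> {1..n}" "i' \<in> {1..n}" "i \<noteq> i'" "rot n i x \<in> ?E" for i i' x
  proof -
    have "i' \<in> cyc n i ` {1..n}" using bij_cyc[of n i] that by (simp add: bij_betw_def)
    then obtain j where j: "j \<in> {1..n}" "cyc n i j = i'" by force
    have "j \<noteq> n"
    proof
      assume "j = n"
      then have "x' (i') = x' i" for x' :: "nat \<Rightarrow> int" using rot_last[OF that(1), of x'] j by (simp add: rot_def)
      from this[of int] show False using that by simp
    qed
    then have "j \<in> {1..n-1}" using j by auto
    then have "rot n i x j < rot n i x n" using that(4) by blast
    then show ?thesis using j by (simp only: rot_last[OF that(1)]) (simp add: rot_def)
  qed
  have "real n * measure_pmf.prob (steps q n) ?E = (\<Sum>i\<in>{1..n}. measure_pmf.prob (steps q n) {x. rot n i x \<in> ?E})"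
    by (simp only: prob_rot) simp
  also have "\<dots> = measure_pmf.prob (steps q n) (\<Union>i\<in>{1..n}. {x. rot n i x \<in> ?E})"
  proof (rule measure_pmf.finite_measure_finite_Union[symmetric])
    show "disjoint_family_on (\<lambda>i. {x. rot n i x \<in> ?E}) {1..n}"
    proof (unfold disjoint_family_on_def, intro ballI impI equals0I)
      fix i i' x assume i: "i \<in> {1..n}" "i' \<in> {1..n}" "i \<noteq> i'"
        and x: "x \<in> {x. rot n i x \<in> ?E} \<inter> {x. rot n i' x \<in> ?E}"
      have "x i' < x i" by (rule less[OF i]) (use x in blast)
      moreover have "x i < x i'" by (rule less[OF i(2,1) i(3)[symmetric]]) (use x in blast)
      ultimately show False by simp
    qed
  qed auto
  also have "\<dots> \<le> measure_pmf.prob (steps q n) {x. psum x n = -1 \<and> H (vervaat n (psum x))}"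
  proof (rule measure_pmf.finite_measure_mono)
    show "(\<Union>i\<in>{1..n}. {x. rot n i x \<in> ?E}) \<subseteq> {x. psum x n = -1 \<and> H (vervaat n (psum x))}"
    proof
      fix x assume "x \<in> (\<Union>i\<in>{1..n}. {x. rot n i x \<in> ?E})"
      then obtain i where i: "rot n i x \<in> ?E" by blast
      then have x: "psum x n = -1" by (simp add: psum_rot)
      have "H (vervaat n (psum (rot n i x))) = H (vervaat n (psum x))"
        by (rule path_eventD[OF H]) (rule vervaat_rot[OF x])
      then show "x \<in> {x. psum x n = -1 \<and> H (vervaat n (psum x))}" using i x by simp
    qed
  qed simp
  finally show ?thesis .
qed

text \<open>Replacing the prescribed last step of the closed path by an independent step costs a factor
  of at least \<open>pm\<close> on \<open>G\<close>; placing it at any of the \<open>n\<close> positions regains the factor \<open>n\<close>.\<close>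

lemma closed_path_prob_le:
  assumes n: "n \<ge> 1" and H: "path_event n H" and pm: "pm > 0"
    and G: "\<And>f. f \<in> G \<Longrightarrow> pm \<le> pmf q (-1 - psum f (n - 1)) \<and> (\<forall>j\<in>{1..n-1}. f j < -1 - psum f (n - 1))"
  shows "real n * pm * measure_pmf.prob (steps q (n - 1)) {f \<in> G. H (vervaat n ((psum f)(n := -1)))}
    \<le> measure_pmf.prob (steps q n) {x. psum x n = -1 \<and> H (vervaat n (psum x))}"
proof -
  let ?H = "\<lambda>x. H (vervaat n (psum x)) \<and> (\<forall>j\<in>{1..n-1}. x j < x n)"
  let ?A = "{f \<in> G. H (vervaat n ((psum f)(n := -1)))}"
  let ?Q = "steps q (n - 1)"
  let ?g = "\<lambda>f. pmf q (-1 - psum f (n - 1)) * indicator {f. ?H (f(n := -1 - psum f (n - 1)))} f :: real"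
  have ig: "integrable (measure_pmf ?Q) ?g"
    by (rule measure_pmf.integrable_const_bound[where B = 1]) (auto simp: indicator_def pmf_le_1)
  have "pm * indicator ?A f \<le> ?g f" for f
  proof (cases "f \<in> ?A")
    case True
    let ?c = "-1 - psum f (n - 1)"
    have agree: "psum (f(n := ?c)) i = ((psum f)(n := -1)) i" if "i \<le> n" for i
    proof (cases "i = n")
      case True
      have "psum (f(n := ?c)) n = psum (f(n := ?c)) (n - 1) + ?c" using n by (cases n) auto
      also have "psum (f(n := ?c)) (n - 1) = psum f (n - 1)" using n by (intro psum_cong) auto
      finally show ?thesis unfolding True fun_upd_same by (rule trans) simp
    next
      case False
      then show ?thesis using that by (auto intro!: psum_cong)
    qed
    have "H (vervaat n (psum (f(n := ?c)))) = H (vervaat n ((psum f)(n := -1)))"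
      by (rule path_eventD[OF H], rule vervaat_cong, rule agree)
    moreover have "\<forall>j\<in>{1..n-1}. (f(n := ?c)) j < (f(n := ?c)) n" using G[of f] True by auto
    ultimately have "?H (f(n := ?c))" using True by blast
    then show ?thesis using G[of f] True by simp
  qed (use pm in simp)
  then have "measure_pmf.expectation ?Q (\<lambda>f. pm * indicator ?A f) \<le> measure_pmf.expectation ?Q ?g"
    by (intro integral_mono ig integrable_mult_right integrable_indicator_pmf)
  then have "pm * measure_pmf.prob ?Q ?A \<le> measure_pmf.prob (steps q n) {x. psum x n = -1 \<and> ?H x}"
    by (simp add: prob_bridge_last_step[OF n])
  then have "real n * (pm * measure_pmf.prob ?Q ?A) \<le> real n * measure_pmf.prob (steps q n) {x. psum x n = -1 \<and> ?H x}"
    by (rule mult_left_mono) simp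
  also have "\<dots> \<le> measure_pmf.prob (steps q n) {x. psum x n = -1 \<and> H (vervaat n (psum x))}"
    by (rule strict_max_last_prob[OF n H])
  finally show ?thesis by (simp add: mult.assoc)
qed

section \<open>Comparison of the two laws\<close>

text \<open>For every event the probability for the closed path exceeds that for the conditioned path by
  at most \<open>2 * e\<close>; as both are probability measures, the complement gives the reverse bound. The
  same inequality for the sure event shows that first passage at time \<open>n\<close> has positive probability.\<close>

theorem (in cauchy_step) conditioned_close_to_closed:
  assumes e: "0 < e" "e < 1"
  shows "\<forall>\<^sub>F n in sequentially. measure_pmf.prob (steps q n) (first_pass n) > 0 \<and>
    (\<forall>H. path_event n H \<longrightarrow>
      \<bar>measure_pmf.prob (steps q n) {x \<in> first_pass n. H (psum x)} / measure_pmf.prob (steps q n) (first_pass n)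
       - measure_pmf.prob (steps q (n - 1)) {f. H (vervaat n ((psum f)(n := -1)))}\<bar> \<le> 2 * e)"
proof -
  obtain G pm where ev: "\<forall>\<^sub>F n in sequentially. pm n > 0 \<and>
     measure_pmf.prob (steps q (n - 1)) (G n) \<ge> 1 - e \<and>
     measure_pmf.prob (steps q n) {x. psum x n = -1} \<le> (1 + e) * (real n * pm n) \<and>
     (\<forall>f\<in>G n. pm n \<le> pmf q (-1 - psum f (n - 1)) \<and> (\<forall>j\<in>{1..n-1}. f j < -1 - psum f (n - 1)))"
    using one_big_jump[OF e(1)] by blast
  show ?thesis using ev eventually_ge_at_top[of 1]
  proof eventually_elim
    case (elim n)
    then have pm: "pm n > 0" and G: "measure_pmf.prob (steps q (n - 1)) (G n) \<ge> 1 - e"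
      and D: "measure_pmf.prob (steps q n) {x. psum x n = -1} \<le> (1 + e) * (real n * pm n)"
      and Gf: "\<And>f. f \<in> G n \<Longrightarrow> pm n \<le> pmf q (-1 - psum f (n - 1)) \<and> (\<forall>j\<in>{1..n-1}. f j < -1 - psum f (n - 1))"
      and n: "n \<ge> 1" by auto
    define Z where "Z H = measure_pmf.prob (steps q (n - 1)) {f. H (vervaat n ((psum f)(n := -1)))}" for H
    define F where "F H = measure_pmf.prob (steps q n) {x \<in> first_pass n. H (psum x)}" for H
    let ?T = "\<lambda>_. True"
    have peT: "path_event n ?T" by (simp add: path_event_def)
    have FT: "F ?T = measure_pmf.prob (steps q n) (first_pass n)" by (simp add: F_def)
    have npm: "real n * pm n > 0" using pm n by simp
    have key: "Z H \<le> e + F H / pm n" if H: "path_event n H" for H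
    proof -
      let ?A = "{f \<in> G n. H (vervaat n ((psum f)(n := -1)))}"
      have "Z H \<le> measure_pmf.prob (steps q (n - 1)) (?A \<union> - G n)"
        unfolding Z_def by (intro measure_pmf.finite_measure_mono) auto
      also have "\<dots> \<le> measure_pmf.prob (steps q (n - 1)) ?A + measure_pmf.prob (steps q (n - 1)) (- G n)"
        by (intro measure_Un_le) auto
      finally have 0: "Z H \<le> measure_pmf.prob (steps q (n - 1)) ?A + measure_pmf.prob (steps q (n - 1)) (- G n)" .
      have "measure_pmf.prob (steps q (n - 1)) (- G n) \<le> e"
        using G measure_pmf.prob_compl[of "G n" "steps q (n - 1)"] by (simp add: Compl_eq_Diff_UNIV)
      then have 1: "Z H \<le> measure_pmf.prob (steps q (n - 1)) ?A + e" using 0 by linarith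
      have "real n * pm n * measure_pmf.prob (steps q (n - 1)) ?A \<le> real n * F H"
        using closed_path_prob_le[OF n H pm Gf] bridge_vervaat_prob[OF H, of q]
        unfolding F_def by simp
      then have "pm n * measure_pmf.prob (steps q (n - 1)) ?A \<le> F H"
        using n by (simp add: mult.assoc)
      then have "measure_pmf.prob (steps q (n - 1)) ?A \<le> F H / pm n"
        using pm by (simp add: field_simps)
      then show ?thesis using 1 by linarith
    qed
    have "Z ?T = 1" by (simp add: Z_def)
    then have "F ?T / pm n > 0" using key[OF peT] e by linarith
    then have Fpos: "F ?T > 0" using pm by (simp add: zero_less_divide_iff)
    have "real n * F ?T \<le> (1 + e) * (real n * pm n)"
      using D bridge_vervaat_prob[OF peT, of q] unfolding F_def by simp
    then have "F ?T \<le> (1 + e) * pm n" using n by (simp add: mult.left_commute)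
    then have ratio: "F ?T / pm n \<le> 1 + e" using pm by (simp add: field_simps)
    have upper: "Z H \<le> F H / F ?T + 2 * e" if H: "path_event n H" for H
    proof -
      have le: "F H \<le> F ?T" unfolding F_def by (intro measure_pmf.finite_measure_mono) auto
      have FH: "0 \<le> F H / F ?T" "F H / F ?T \<le> 1" using le Fpos by (auto simp: F_def)
      have "F H / pm n = (F H / F ?T) * (F ?T / pm n)" using Fpos by simp
      also have "\<dots> \<le> (F H / F ?T) * (1 + e)" using ratio FH by (intro mult_left_mono) auto
      also have "\<dots> = F H / F ?T + (F H / F ?T) * e" by (simp add: distrib_left)
      also have "(F H / F ?T) * e \<le> 1 * e" using FH e by (intro mult_right_mono) auto
      finally show ?thesis using key[OF H] by simp
    qed
    have "\<bar>F H / F ?T - Z H\<bar> \<le> 2 * e" if H: "path_event n H" for H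
    proof -
      have H': "path_event n (\<lambda>w. \<not> H w)" using H unfolding path_event_def by blast
      have "F H + F (\<lambda>w. \<not> H w) = F ?T"
        unfolding F_def by (subst measure_pmf.finite_measure_Union[symmetric]) (auto intro!: arg_cong[of _ _ "measure_pmf.prob _"])
      then have "F (\<lambda>w. \<not> H w) / F ?T = 1 - F H / F ?T" using Fpos by (simp add: field_simps)
      moreover have "Z H + Z (\<lambda>w. \<not> H w) = 1"
      proof -
        have "{f. \<not> H (vervaat n ((psum f)(n := -1)))} = - {f. H (vervaat n ((psum f)(n := -1)))}" by auto
        then show ?thesis unfolding Z_def
          using measure_pmf.prob_compl[of "{f. H (vervaat n ((psum f)(n := -1)))}" "steps q (n - 1)"]
          by (simp add: Compl_eq_Diff_UNIV)
      qed
      ultimately show ?thesis using upper[OF H] upper[OF H'] by (simp add: abs_le_iff)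
    qed
    then show ?case using Fpos unfolding FT unfolding F_def Z_def by simp
  qed
qed

section \<open>Transfer to random variables\<close>

definition trunc_seq :: "nat \<Rightarrow> (nat \<Rightarrow> int) \<Rightarrow> nat \<Rightarrow> int" where
  "trunc_seq n x = (\<lambda>j. if j \<in> {1..n} then x j else 0)"

lemma psum_trunc_seq: "i \<le> n \<Longrightarrow> psum (trunc_seq n x) i = psum x i"
  by (rule psum_cong) (auto simp: trunc_seq_def)

lemma walk_eq_psum: "walk Xs i \<omega> = psum (\<lambda>j. Xs j \<omega>) i"
  by (simp add: walk_def psum_def)

lemma countable_finitely_supported: "countable {x :: nat \<Rightarrow> int. \<forall>j. j \<notin> {1..n} \<longrightarrow> x j = 0}"
proof -
  have "{x :: nat \<Rightarrow> int. \<forall>j. j \<notin> {1..n} \<longrightarrow> x j = 0} = PiE_dflt {1..n} 0 (\<lambda>_. UNIV)"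
    by (auto simp: PiE_dflt_def)
  also have "\<dots> = (\<lambda>h x. if x \<in> {1..n} then h x else 0) ` PiE {1..n} (\<lambda>_. UNIV)"
    by (rule dflt_image_PiE[symmetric])
  also have "countable \<dots>" by (intro countable_image countable_PiE) auto
  finally show ?thesis .
qed

text \<open>On a countable type the atoms of measure zero form a null set.\<close>

lemma pmf_of_distr:
  fixes D :: "int measure"
  assumes "prob_space D" "sets D = UNIV"
  shows "\<exists>q. measure_pmf q = D"
proof -
  have "AE x in D. measure D {x} \<noteq> 0"
  proof -
    interpret prob_space D by fact
    have "(\<Union>x\<in>{x. measure D {x} = 0}. {x}) \<in> null_sets D"
      using assms(2) by (intro null_sets_UN') (auto simp: null_sets_def emeasure_eq_measure)
    then have "AE x in D. x \<notin> (\<Union>x\<in>{x. measure D {x} = 0}. {x})" by (rule AE_not_in)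
    then show ?thesis by eventually_elim auto
  qed
  then have "measure_pmf (Abs_pmf D) = D"
    using assms by (intro Abs_pmf_inverse) auto
  then show ?thesis by blast
qed

locale iid_steps = prob_space M for M :: "'b measure" +
  fixes Xs :: "nat \<Rightarrow> 'b \<Rightarrow> int" and q :: "int pmf"
  assumes indep: "indep_vars (\<lambda>_. count_space UNIV) Xs {1..}"
    and dist: "\<And>i. i \<ge> 1 \<Longrightarrow> distr M (count_space UNIV) (Xs i) = measure_pmf q"
begin

lemma Xs_measurable: "i \<ge> 1 \<Longrightarrow> Xs i \<in> measurable M (count_space UNIV)"
  using indep by (simp add: indep_vars_def)

definition vec :: "nat \<Rightarrow> 'b \<Rightarrow> nat \<Rightarrow> int" where
  "vec n \<omega> = trunc_seq n (\<lambda>j. Xs j \<omega>)"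

lemma vec_vimage:
  assumes "\<And>j. j \<notin> {1..n} \<Longrightarrow> x j = 0" "n \<ge> 1"
  shows "vec n -` {x} \<inter> space M = (\<Inter>j\<in>{1..n}. Xs j -` {x j} \<inter> space M)"
  using assms by (auto simp: vec_def trunc_seq_def fun_eq_iff)

lemma vec_measurable:
  assumes "n \<ge> 1"
  shows "vec n \<in> measurable M (count_space UNIV)"
proof -
  let ?O = "{x :: nat \<Rightarrow> int. \<forall>j. j \<notin> {1..n} \<longrightarrow> x j = 0}"
  have "vec n \<in> measurable M (count_space ?O)"
  proof (subst measurable_count_space_eq_countable[OF countable_finitely_supported], intro conjI ballI)
    show "vec n \<in> space M \<rightarrow> ?O" by (auto simp: vec_def trunc_seq_def)
    fix x assume "x \<in> ?O"
    then have "vec n -` {x} \<inter> space M = (\<Inter>j\<in>{1..n}. Xs j -` {x j} \<inter> space M)"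
      using assms by (intro vec_vimage) auto
    also have "\<dots> \<in> sets M"
      using assms by (intro sets.finite_INT measurable_sets[OF Xs_measurable]) auto
    finally show "vec n -` {x} \<inter> space M \<in> sets M" .
  qed
  from measurable_compose[OF this, of "\<lambda>x. x" "count_space UNIV"] show ?thesis by simp
qed

text \<open>Both laws are concentrated on the countable set of sequences vanishing outside \<open>{1..n}\<close>, and
  independence gives the same mass to every point of it.\<close>

lemma distr_vec:
  assumes n: "n \<ge> 1"
  shows "distr M (count_space UNIV) (vec n) = measure_pmf (steps q n)"
proof (rule measure_eqI_countable_AE)
  let ?O = "{x :: nat \<Rightarrow> int. \<forall>j. j \<notin> {1..n} \<longrightarrow> x j = 0}"
  show "countable ?O" by (rule countable_finitely_supported)
  show "AE x in distr M (count_space UNIV) (vec n). x \<in> ?O"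
    by (subst AE_distr_iff[OF vec_measurable[OF n]]) (auto simp: vec_def trunc_seq_def)
  show "AE x in measure_pmf (steps q n). x \<in> ?O"
    using set_Pi_pmf_subset[of "{1..n}" 0 "\<lambda>_. q"] by (intro AE_pmfI) (auto simp: steps_def)
  fix x assume x: "x \<in> ?O"
  have "emeasure (distr M (count_space UNIV) (vec n)) {x} = emeasure M (vec n -` {x} \<inter> space M)"
    by (rule emeasure_distr[OF vec_measurable[OF n]]) simp
  also have "vec n -` {x} \<inter> space M = (\<Inter>j\<in>{1..n}. Xs j -` {x j} \<inter> space M)"
    using x n by (intro vec_vimage) auto
  also have "emeasure M \<dots> = ennreal (prob \<dots>)" by (rule emeasure_eq_measure)
  also have "prob (\<Inter>j\<in>{1..n}. Xs j -` {x j} \<inter> space M) = (\<Prod>j\<in>{1..n}. prob (Xs j -` {x j} \<inter> space M))"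
    using n by (intro indep_varsD[OF indep]) auto
  also have "\<dots> = (\<Prod>j\<in>{1..n}. pmf q (x j))"
  proof (intro prod.cong refl)
    fix j assume "j \<in> {1..n}"
    then have j: "j \<ge> 1" by simp
    have "prob (Xs j -` {x j} \<inter> space M) = measure (distr M (count_space UNIV) (Xs j)) {x j}"
      by (subst measure_distr[OF Xs_measurable[OF j]]) auto
    then show "prob (Xs j -` {x j} \<inter> space M) = pmf q (x j)"
      by (simp add: dist[OF j] measure_pmf_single)
  qed
  also have "\<dots> = pmf (steps q n) x"
    using x unfolding steps_def by (subst pmf_Pi') auto
  finally show "emeasure (distr M (count_space UNIV) (vec n)) {x} = emeasure (measure_pmf (steps q n)) {x}"
    by (simp add: emeasure_pmf_single)
qed auto

lemma vec_event:
  assumes n: "n \<ge> 1"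
  shows "{\<omega> \<in> space M. vec n \<omega> \<in> B} \<in> sets M"
    and "prob {\<omega> \<in> space M. vec n \<omega> \<in> B} = measure_pmf.prob (steps q n) B"
proof -
  have eq: "{\<omega> \<in> space M. vec n \<omega> \<in> B} = vec n -` B \<inter> space M" by auto
  show "{\<omega> \<in> space M. vec n \<omega> \<in> B} \<in> sets M"
    unfolding eq by (rule measurable_sets[OF vec_measurable[OF n]]) simp
  have "measure_pmf.prob (steps q n) B = measure (distr M (count_space UNIV) (vec n)) B"
    by (simp add: distr_vec[OF n])
  also have "\<dots> = prob (vec n -` B \<inter> space M)"
    by (rule measure_distr[OF vec_measurable[OF n]]) simp
  finally show "prob {\<omega> \<in> space M. vec n \<omega> \<in> B} = measure_pmf.prob (steps q n) B" by (simp add: eq)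
qed

lemma walk_vec: "i \<le> n \<Longrightarrow> walk Xs i \<omega> = psum (vec n \<omega>) i"
  by (simp add: walk_eq_psum vec_def psum_trunc_seq)

end

lemma first_negative_eq_iff:
  assumes "n \<ge> 1"
  shows "first_negative w = enat n \<longleftrightarrow> w n < 0 \<and> (\<forall>i\<in>{1..<n}. w i \<ge> 0)"
proof -
  let ?S = "{i. i \<ge> 1 \<and> w i < 0}"
  have lb: "first_negative w \<le> enat i" if "i \<in> ?S" for i
    unfolding first_negative_def by (rule Inf_lower, rule imageI, rule that)
  have att: "first_negative w \<in> enat ` ?S" if ne: "?S \<noteq> {}"
  proof -
    obtain i where "i \<in> ?S" using ne by blast
    then have "enat i \<in> enat ` ?S" by (rule imageI)
    then show ?thesis unfolding first_negative_def by (rule wellorder_InfI)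
  qed
  show ?thesis
  proof
    assume A: "first_negative w = enat n"
    have "?S \<noteq> {}"
    proof
      assume "?S = {}"
      then have "first_negative w = \<infinity>" unfolding first_negative_def
        by (simp only: image_empty Inf_empty top_enat_def)
      then show False using A by simp
    qed
    then have "n \<in> ?S" using att A by force
    moreover have "w i \<ge> 0" if "i \<in> {1..<n}" for i
      using lb[of i] that A by (cases "w i < 0") auto
    ultimately show "w n < 0 \<and> (\<forall>i\<in>{1..<n}. w i \<ge> 0)" by auto
  next
    assume A: "w n < 0 \<and> (\<forall>i\<in>{1..<n}. w i \<ge> 0)"
    then have n: "n \<in> ?S" using assms by simp
    then obtain i where i: "first_negative w = enat i" "i \<in> ?S" using att by blast
    have "i \<le> n" using lb[OF n] i by simp
    moreover have "\<not> i < n" using A i(2) by force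
    ultimately show "first_negative w = enat n" using i by simp
  qed
qed

text \<open>A downward skip-free walk becomes negative by hitting \<open>-1\<close>.\<close>

lemma first_negative_prob_eq_first_pass:
  assumes skip: "set_pmf q \<subseteq> {-1..}" and n: "n \<ge> 1"
  shows "measure_pmf.prob (steps q n) {x. first_negative (psum x) = enat n \<and> H x}
    = measure_pmf.prob (steps q n) {x \<in> first_pass n. H x}"
proof (rule measure_pmf.finite_measure_eq_AE)
  show "AE x in measure_pmf (steps q n). (x \<in> {x. first_negative (psum x) = enat n \<and> H x}) = (x \<in> {x \<in> first_pass n. H x})"
  proof (rule AE_pmfI)
    fix x assume "x \<in> set_pmf (steps q n)"
    then have "x n \<in> set_pmf q" using n by (auto simp: steps_def set_Pi_pmf PiE_dflt_def)
    then have xn: "x n \<ge> -1" using skip by auto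
    have sn: "psum x n = psum x (n - 1) + x n" using n by (cases n) auto
    have "first_negative (psum x) = enat n \<longleftrightarrow> x \<in> first_pass n"
    proof
      assume A: "first_negative (psum x) = enat n"
      then have A: "psum x n < 0" "\<And>i. i \<in> {1..<n} \<Longrightarrow> psum x i \<ge> 0"
        using first_negative_eq_iff[OF n] by auto
      have nonneg: "psum x i \<ge> 0" if "i < n" for i using A(2)[of i] that by (cases "i = 0") auto
      have "psum x (n - 1) \<ge> 0" using n by (intro nonneg) simp
      then have "psum x n = -1" using sn xn A(1) by linarith
      then show "x \<in> first_pass n" using nonneg by (simp add: first_pass_def)
    next
      assume "x \<in> first_pass n"
      then show "first_negative (psum x) = enat n"
        by (subst first_negative_eq_iff[OF n]) (auto simp: first_pass_def)
    qed
    then show "(x \<in> {x. first_negative (psum x) = enat n \<and> H x}) = (x \<in> {x \<in> first_pass n. H x})" by simp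
  qed
qed auto

lemma (in iid_steps) laws_of_path_events:
  assumes skip: "set_pmf q \<subseteq> {-1..}" and n: "n \<ge> 2"
    and pos: "measure_pmf.prob (steps q n) (first_pass n) > 0"
    and A: "A \<in> sets (Pi\<^sub>M {0..n} (\<lambda>_. borel :: real measure))"
  defines "H \<equiv> \<lambda>w. (\<lambda>i\<in>{0..n}. real_of_int (w i)) \<in> A"
  shows "path_event n H"
    and "measure (W_law M Xs n) A =
      measure_pmf.prob (steps q n) {x \<in> first_pass n. H (psum x)} / measure_pmf.prob (steps q n) (first_pass n)"
    and "measure (Z_law M Xs n) A = measure_pmf.prob (steps q (n - 1)) {f. H (vervaat n ((psum f)(n := -1)))}"
proof -
  show pe: "path_event n H"
    unfolding path_event_def H_def
  proof (intro allI impI)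
    fix w w' :: "nat \<Rightarrow> int" assume "\<forall>i\<le>n. w i = w' i"
    then have "(\<lambda>i\<in>{0..n}. real_of_int (w i)) = (\<lambda>i\<in>{0..n}. real_of_int (w' i))"
      by (intro restrict_ext) auto
    then show "((\<lambda>i\<in>{0..n}. real_of_int (w i)) \<in> A) = ((\<lambda>i\<in>{0..n}. real_of_int (w' i)) \<in> A)" by simp
  qed
  have n1: "n \<ge> 1" "n - 1 \<ge> 1" using n by auto
  let ?K = "Pi\<^sub>M {0..n} (\<lambda>_. borel :: real measure)"
  have meas: "(\<lambda>\<omega>. \<lambda>i\<in>{0..n}. real_of_int (Y (vec m \<omega>) i)) \<in> measurable M ?K"
    if "m \<ge> 1" for m and Y :: "(nat \<Rightarrow> int) \<Rightarrow> nat \<Rightarrow> int"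
  proof (rule measurable_compose[OF vec_measurable[OF that]])
    show "(\<lambda>x. \<lambda>i\<in>{0..n}. real_of_int (Y x i)) \<in> measurable (count_space UNIV) ?K"
      by (intro measurable_restrict) simp
  qed
  define E where "E = {\<omega> \<in> space M. first_negative (\<lambda>i. walk Xs i \<omega>) = enat n}"
  have Eeq: "E = {\<omega> \<in> space M. vec n \<omega> \<in> {x. first_negative (psum x) = enat n}}"
    unfolding E_def using n1 by (intro Collect_cong) (auto simp: first_negative_eq_iff walk_vec[of _ n])
  have Es: "E \<in> sets M" unfolding Eeq by (rule vec_event(1)[OF n1(1)])
  have pE: "prob E = measure_pmf.prob (steps q n) (first_pass n)"
    unfolding Eeq vec_event(2)[OF n1(1)] using first_negative_prob_eq_first_pass[OF skip n1(1), where H = "\<lambda>_. True"] by simp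
  have gW: "(\<lambda>\<omega>. \<lambda>i\<in>{0..n}. real_of_int (walk Xs i \<omega>)) = (\<lambda>\<omega>. \<lambda>i\<in>{0..n}. real_of_int (psum (vec n \<omega>) i))"
    by (intro ext restrict_ext) (simp add: walk_vec[of _ n])
  have mW: "(\<lambda>\<omega>. \<lambda>i\<in>{0..n}. real_of_int (walk Xs i \<omega>)) \<in> measurable M ?K"
    unfolding gW by (rule meas[OF n1(1)])
  let ?B = "(\<lambda>\<omega>. \<lambda>i\<in>{0..n}. real_of_int (walk Xs i \<omega>)) -` A \<inter> space M"
  have "measure (W_law M Xs n) A = measure (uniform_measure M E) ?B"
    unfolding W_law_def path_law_def E_def[symmetric]
    using mW A by (subst measure_distr) (auto simp: measurable_def)
  also have "\<dots> = prob (E \<inter> ?B) / prob E"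
    using pos pE measurable_sets[OF mW A] by (intro measure_uniform_measure) (auto simp: emeasure_eq_measure)
  also have "E \<inter> ?B = {\<omega> \<in> space M. vec n \<omega> \<in> {x. first_negative (psum x) = enat n \<and> H (psum x)}}"
    unfolding Eeq gW H_def by auto
  also have "prob \<dots> = measure_pmf.prob (steps q n) {x \<in> first_pass n. H (psum x)}"
    unfolding vec_event(2)[OF n1(1)] by (rule first_negative_prob_eq_first_pass[OF skip n1(1)])
  finally show "measure (W_law M Xs n) A =
      measure_pmf.prob (steps q n) {x \<in> first_pass n. H (psum x)} / measure_pmf.prob (steps q n) (first_pass n)"
    by (simp add: pE)
  have gZ: "(\<lambda>\<omega>. \<lambda>i\<in>{0..n}. real_of_int (vervaat n ((\<lambda>i. walk Xs i \<omega>)(n := -1)) i))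
      = (\<lambda>\<omega>. \<lambda>i\<in>{0..n}. real_of_int (vervaat n ((psum (vec (n - 1) \<omega>))(n := -1)) i))"
  proof (rule ext, rule restrict_ext)
    fix \<omega> i assume i: "i \<in> {0..n}"
    have "vervaat n ((\<lambda>i. walk Xs i \<omega>)(n := -1)) i = vervaat n ((psum (vec (n - 1) \<omega>))(n := -1)) i"
      by (rule vervaat_cong) (use i in \<open>auto simp: walk_vec[of _ "n - 1"]\<close>)
    then show "real_of_int (vervaat n ((\<lambda>i. walk Xs i \<omega>)(n := -1)) i) = real_of_int (vervaat n ((psum (vec (n - 1) \<omega>))(n := -1)) i)"
      by simp
  qed
  have "measure (Z_law M Xs n) A = prob ((\<lambda>\<omega>. \<lambda>i\<in>{0..n}. real_of_int (vervaat n ((psum (vec (n - 1) \<omega>))(n := -1)) i)) -` A \<inter> space M)"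
    unfolding Z_law_def path_law_def gZ by (rule measure_distr[OF meas[OF n1(2)] A])
  also have "(\<lambda>\<omega>. \<lambda>i\<in>{0..n}. real_of_int (vervaat n ((psum (vec (n - 1) \<omega>))(n := -1)) i)) -` A \<inter> space M
     = {\<omega> \<in> space M. vec (n - 1) \<omega> \<in> {f. H (vervaat n ((psum f)(n := -1)))}}"
    unfolding H_def by auto
  also have "prob \<dots> = measure_pmf.prob (steps q (n - 1)) {f. H (vervaat n ((psum f)(n := -1)))}"
    by (rule vec_event(2)[OF n1(2)])
  finally show "measure (Z_law M Xs n) A = measure_pmf.prob (steps q (n - 1)) {f. H (vervaat n ((psum f)(n := -1)))}" .
qed

lemma tv_dist_le:
  assumes "\<And>A. A \<in> sets \<mu> \<Longrightarrow> \<bar>measure \<mu> A - measure \<nu> A\<bar> \<le> e"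
  shows "0 \<le> tv_dist \<mu> \<nu>" "tv_dist \<mu> \<nu> \<le> e"
proof -
  show "tv_dist \<mu> \<nu> \<le> e" unfolding tv_dist_def
    using assms by (intro cSUP_least) auto
  have "\<bar>measure \<mu> {} - measure \<nu> {}\<bar> \<le> tv_dist \<mu> \<nu>"
    unfolding tv_dist_def
    by (rule cSUP_upper) (use assms in \<open>auto intro!: bdd_aboveI2\<close>)
  then show "0 \<le> tv_dist \<mu> \<nu>" by simp
qed

text \<open>The density times the squared argument is asymptotic to \<open>L\<close> along the integers and inherits
  its slow variation.\<close>

lemma cauchy_step_of_tail:
  fixes P :: "'a measure" and X :: "'a \<Rightarrow> int"
  assumes P: "prob_space P" and X: "X \<in> measurable P (count_space UNIV)"
    and int: "integrable P (\<lambda>\<omega>. real_of_int (X \<omega>))" "(\<integral>\<omega>. real_of_int (X \<omega>) \<partial>P) = 0"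
    and skip: "measure P {\<omega>\<in>space P. X \<omega> < -1} = 0"
    and L: "slowly_varying L"
    and tail: "(\<lambda>x::int. measure P {\<omega>\<in>space P. X \<omega> = x}) \<sim>[at_top] (\<lambda>x. L (real_of_int x) / (real_of_int x)\<^sup>2)"
  shows "\<exists>q. measure_pmf q = distr P (count_space UNIV) X \<and> cauchy_step q"
proof -
  interpret prob_space P by fact
  obtain q where q: "measure_pmf q = distr P (count_space UNIV) X"
    using pmf_of_distr[of "distr P (count_space UNIV) X"] prob_space_distr[OF X] by auto
  have pq: "pmf q x = prob {\<omega>\<in>space P. X \<omega> = x}" for x
  proof -
    have "pmf q x = measure (distr P (count_space UNIV) X) {x}" by (simp add: measure_pmf_single flip: q)
    also have "\<dots> = prob (X -` {x} \<inter> space P)" by (rule measure_distr[OF X]) simp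
    also have "X -` {x} \<inter> space P = {\<omega>\<in>space P. X \<omega> = x}" by auto
    finally show ?thesis .
  qed
  have "cauchy_step q"
  proof
    fix x assume x: "x \<in> set_pmf q"
    show "x \<ge> -1"
    proof (rule ccontr)
      assume "\<not> x \<ge> -1"
      then have "prob {\<omega>\<in>space P. X \<omega> = x} \<le> prob {\<omega>\<in>space P. X \<omega> < -1}"
        using X by (intro finite_measure_mono) auto
      then have "pmf q x = 0" using skip pq[of x] measure_nonneg[of P] by (simp add: order_antisym)
      then show False using x by (simp add: set_pmf_iff)
    qed
  next
    show "integrable (measure_pmf q) real_of_int"
      unfolding q using X int(1) by (subst integrable_distr_eq) auto
    show "measure_pmf.expectation q real_of_int = 0"
      unfolding q using X int(2) by (subst integral_distr) auto
    have lim: "filterlim int at_top at_top"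
      by (rule filterlim_int_sequentially)
    have "(\<lambda>m. pmf q (int m)) \<sim>[at_top] (\<lambda>m. L (real m) / (real m)\<^sup>2)"
      using asymp_equiv_compose'[OF tail lim] by (simp add: pq)
    then have "(\<lambda>m. (real m)\<^sup>2 * pmf q (int m)) \<sim>[at_top] (\<lambda>m. (real m)\<^sup>2 * (L (real m) / (real m)\<^sup>2))"
      by (intro asymp_equiv_mult asymp_equiv_refl)
    also have "(\<lambda>m. (real m)\<^sup>2 * (L (real m) / (real m)\<^sup>2)) \<sim>[at_top] (\<lambda>m. L (real m))"
      by (rule asymp_equiv_refl_ev) (use eventually_gt_at_top[of 0] in eventually_elim, simp)
    finally show "slowly_varying_seq (\<lambda>m. (real m)\<^sup>2 * pmf q (int m))"
      by (rule slowly_varying_seq_asymp_equiv[OF L])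
  qed
  then show ?thesis using q by blast
qed

theorem theorem21:
  fixes P :: "'a measure" and X :: "'a \<Rightarrow> int" and L :: "real \<Rightarrow> real"
    and M :: "'b measure" and Xs :: "nat \<Rightarrow> 'b \<Rightarrow> int"
  assumes "prob_space P"
    and "X \<in> measurable P (count_space UNIV)"
    and "integrable P (\<lambda>\<omega>. real_of_int (X \<omega>))"
    and "(\<integral>\<omega>. real_of_int (X \<omega>) \<partial>P) = 0"
    and "measure P {\<omega>\<in>space P. X \<omega> < -1} = 0"
    and "slowly_varying L"
    and "(\<lambda>x::int. measure P {\<omega>\<in>space P. X \<omega> = x})
           \<sim>[at_top] (\<lambda>x. L (real_of_int x) / (real_of_int x)\<^sup>2)"
    and "prob_space M"
    and "prob_space.indep_vars M (\<lambda>_. count_space UNIV) Xs {1..}"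
    and "\<And>i. i \<ge> 1 \<Longrightarrow>
           distr M (count_space UNIV) (Xs i) = distr P (count_space UNIV) X"
  shows "(\<lambda>n. tv_dist (W_law M Xs n) (Z_law M Xs n)) \<longlonglongrightarrow> 0"
proof -
  obtain q where q: "measure_pmf q = distr P (count_space UNIV) X" "cauchy_step q"
    using cauchy_step_of_tail[OF assms(1-7)] by blast
  interpret prob_space M by fact
  interpret iid_steps M Xs q
    by unfold_locales (use assms(9,10) q(1) in auto)
  interpret cauchy_step q by fact
  have skip: "set_pmf q \<subseteq> {-1..}" using skip_free by auto
  show ?thesis
  proof (rule tendstoI)
    fix e :: real assume e: "e > 0"
    define d where "d = min (1/2) (e / 4)"
    have d: "0 < d" "d < 1" "2 * d < e" using e by (auto simp: d_def)
    show "\<forall>\<^sub>F n in sequentially. dist (tv_dist (W_law M Xs n) (Z_law M Xs n)) 0 < e"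
      using conditioned_close_to_closed[OF d(1,2)] eventually_ge_at_top[of 2]
    proof eventually_elim
      case (elim n)
      then have pos: "measure_pmf.prob (steps q n) (first_pass n) > 0" by blast
      have "\<bar>measure (W_law M Xs n) A - measure (Z_law M Xs n) A\<bar> \<le> 2 * d"
        if "A \<in> sets (W_law M Xs n)" for A
      proof -
        have A: "A \<in> sets (Pi\<^sub>M {0..n} (\<lambda>_. borel :: real measure))"
          using that by (simp add: W_law_def path_law_def)
        note laws = laws_of_path_events[OF skip elim(2) pos A]
        show ?thesis
          unfolding laws(2,3) by (rule elim(1)[THEN conjunct2, THEN spec, THEN mp, OF laws(1)])
      qed
      from tv_dist_le[OF this] show ?case using d(3) by (simp add: dist_real_def)
    qed
  qed
qed

end
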